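(* Let $2<p<\infty$ and let $A$ be a countably infinite set. Let $P_1,P_2$ be partitions of $A$ with weights $W_1=(w_{1k})_{k\in A}$, $W_2=(w_{2k})_{k\in A}$ in $(0,1]$ such that for every $N\in P_1$ there is an $M\in P_2$ with $N\subset M$ and $w_{1k}\ge w_{2k}$ for all $k\in N$. Let $X$ be the Banach space of all $(x_j)_{j\in A}\in\mathbb{R}^A$ for which $$\|(x_j)\|_X=\max\Big\{\Big(\sum_{j\in A}|x_j|^p\Big)^{1/p},\Big(\sum_{N\in P_1}\Big(\sum_{j\in N}x_j^2w_{1j}^2\Big)^{p/2}\Big)^{1/p},\Big(\sum_{M\in P_2}\Big(\sum_{j\in M}x_j^2w_{2j}^2\Big)^{p/2}\Big)^{1/p}\Big\}$$ is finite. Write $\|(x_j)\|_2=(\sum_{j\in A} x_j^2)^{1/2}$. (1) Assume $\inf_k w_{2k}=\delta>0$. (a) If $|P_2|<\infty$, then $$\delta|P_2|^{\frac1p-\frac12}\|(x_j)\|_2\le\delta\Big(\sum_{M\in P_2}\Big(\sum_{j\in M}x_j^2\Big)^{p/2}\Big)^{1/p}\le\|(x_j)\|_X\le\|(x_j)\|_2,$$ and therefore $X\sim\ell_2$. (b) If $|P_2|=\infty$ and $|M|<\infty$ for all $M\in P_2$, then $\|(x_j)\|_X$ is equivalent to $\big(\sum_{M\in P_2}(\sum_{j\in M}x_j^2)^{p/2}\big)^{1/p}$, so $X\sim(\sum_{M\in P_2}Y_M)_{\ell_p}$, where $Y_M$ is $\mathbb{R}^M$ with norm $(\sum_{j\in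 M}x_j^2)^{1/2}$, and $X\sim\ell_p$. (c) If $|P_2|=\infty$ and $|M|=\infty$ for at least one and at most finitely many $M\in P_2$, then $X\sim\ell_2\oplus\ell_p$. (d) If $|P_2|=\infty$ and $|M|=\infty$ for infinitely many $M\in P_2$, then $\|(x_j)\|_X$ is equivalent to $$\Big(\sum_{|M|=\infty}\Big(\sum_{j\in M}x_j^2\Big)^{p/2}+\sum_{|M|<\infty}\Big(\sum_{j\in M}x_j^2\Big)^{p/2}\Big)^{1/p}$$ (sums over $M\in P_2$), and $X\sim(\sum\ell_2)_{\ell_p}$. (2) Assume $\inf_k w_{1k}=\gamma>0$ and $\inf_k w_{2k}=0$. (a) If $|P_1|<\infty$, then $$\gamma|P_1|^{\frac1p-\frac12}\|(x_j)\|_2\le\gamma\Big(\sum_{N\in P_1}\Big(\sum_{j\in N}x_j^2\Big)^{p/2}\Big)^{1/p}\le\|(x_j)\|_X\le\|(x_j)\|_2,$$ so $X\sim\ell_2$. (b) Suppose $|P_1|=\infty$ and $|N|<\infty$ for all $N\in P_1$, that for every $M\in P_2$ the quantity $C_M=\sum_{n\in M}w_{2n}^{\frac{2p}{p-2}}$ is finite, and that $\sup_{M\in P_2}C_M<\infty$. Then $X\sim\ell_p$.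
   Context: $|P|$ and $|M|$ denote cardinalities of the partition $P$ and of the set $M$. $X\sim Y$ means that the Banach spaces $X$ and $Y$ are isomorphic (linearly homeomorphic). Equivalence of norms means each is bounded by a constant multiple of the other. $(\sum Y_n)_{\ell_p}$ is the $\ell_p$-direct sum with norm $(\sum\|y_n\|^p)^{1/p}$, and $(\sum\ell_2)_{\ell_p}$ is the $\ell_p$-sum of countably infinitely many copies of $\ell_2$. By the paper's convention, the discrete partition with constant weight $1$, giving the term $(\sum|x_j|^p)^{1/p}$, is always included in the norm but not counted among the partitions. *)

theory Defs
  imports
    "HOL-Analysis.Analysis"
    "HOL-Library.Function_Algebras"
    "HOL-Library.Disjoint_Sets"
begin

text \<open>Pointwise scalar multiplication; the pointwise additive structure on functions
  is the one of \<^theory>\<open>HOL-Library.Function_Algebras\<close>.\<close>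

instantiation "fun" :: (type, real_vector) real_vector
begin

definition scaleR_fun :: "real \<Rightarrow> ('a \<Rightarrow> 'b) \<Rightarrow> 'a \<Rightarrow> 'b"
  where "scaleR_fun c f = (\<lambda>x. c *\<^sub>R f x)"

instance
  by standard (auto simp: scaleR_fun_def plus_fun_def fun_eq_iff algebra_simps)

end

text \<open>The spaces depend on parameters (exponents, weights, partitions), so a normed space is
  represented by a carrier set in an ambient real vector space and a norm that is
  meaningful on the carrier only.\<close>

record 'v nspace =
  vecs :: "'v set"
  vnorm :: "'v \<Rightarrow> real"

definition nspace_linear ::
    "'v::real_vector nspace \<Rightarrow> 'u::real_vector nspace \<Rightarrow> ('v \<Rightarrow> 'u) \<Rightarrow> bool"
  where "nspace_linear X Y T \<longleftrightarrow>
    T ` vecs X \<subseteq> vecs Y \<and>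
    (\<forall>x\<in>vecs X. \<forall>y\<in>vecs X. T (x + y) = T x + T y) \<and>
    (\<forall>c. \<forall>x\<in>vecs X. T (c *\<^sub>R x) = c *\<^sub>R T x)"

definition nspace_continuous ::
    "'v::real_vector nspace \<Rightarrow> 'u::real_vector nspace \<Rightarrow> ('v \<Rightarrow> 'u) \<Rightarrow> bool"
  where "nspace_continuous X Y T \<longleftrightarrow>
    (\<forall>x\<in>vecs X. \<forall>e>0. \<exists>d>0. \<forall>y\<in>vecs X.
       vnorm X (y - x) < d \<longrightarrow> vnorm Y (T y - T x) < e)"

definition nspace_isomorphic ::
    "'v::real_vector nspace \<Rightarrow> 'u::real_vector nspace \<Rightarrow> bool" (infix "\<sim>\<^sub>B" 50)
  where "X \<sim>\<^sub>B Y \<longleftrightarrow>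
    (\<exists>T. nspace_linear X Y T \<and> bij_betw T (vecs X) (vecs Y) \<and>
         nspace_continuous X Y T \<and>
         nspace_continuous Y X (inv_into (vecs X) T))"

text \<open>Norm formulas are evaluated in \<open>[0,\<infinity>]\<close>, where every sum of nonnegative terms exists, and a
  family \<open>(x\<^sub>j)\<^sub>j\<^sub>\<in>\<^sub>A\<close> is a function of which only the values on \<open>A\<close> are used.\<close>

text \<open>Only used with \<open>r > 0\<close>.\<close>

definition epowr :: "ennreal \<Rightarrow> real \<Rightarrow> ennreal"
  where "epowr t r = (if t = top then top else ennreal (enn2real t powr r))"

definition lp_enorm :: "real \<Rightarrow> 'a set \<Rightarrow> ('a \<Rightarrow> real) \<Rightarrow> ennreal"
  where "lp_enorm p A x = epowr (\<Sum>\<^sub>\<infinity>j\<in>A. ennreal (\<bar>x j\<bar> powr p)) (1 / p)"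

definition partition_enorm ::
    "real \<Rightarrow> 'a set set \<Rightarrow> ('a \<Rightarrow> real) \<Rightarrow> ('a \<Rightarrow> real) \<Rightarrow> ennreal"
  where "partition_enorm p P w x =
    epowr (\<Sum>\<^sub>\<infinity>N\<in>P. epowr (\<Sum>\<^sub>\<infinity>j\<in>N. ennreal ((x j)\<^sup>2 * (w j)\<^sup>2)) (p / 2)) (1 / p)"

definition X_enorm ::
    "real \<Rightarrow> 'a set \<Rightarrow> 'a set set \<Rightarrow> ('a \<Rightarrow> real) \<Rightarrow> 'a set set \<Rightarrow> ('a \<Rightarrow> real) \<Rightarrow>
     ('a \<Rightarrow> real) \<Rightarrow> ennreal"
  where "X_enorm p A P1 w1 P2 w2 x =
    Max {lp_enorm p A x, partition_enorm p P1 w1 x, partition_enorm p P2 w2 x}"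

text \<open>Equivalence of extended norms; in particular, equivalent norms are finite on the same
  families.\<close>

definition enorm_equivalent :: "('v \<Rightarrow> ennreal) \<Rightarrow> ('v \<Rightarrow> ennreal) \<Rightarrow> bool"
  where "enorm_equivalent N N' \<longleftrightarrow>
    (\<exists>c>0. \<exists>C>0. \<forall>x. ennreal c * N x \<le> N' x \<and> N' x \<le> ennreal C * N x)"

text \<open>Elements of \<open>\<real>\<^sup>A\<close> are encoded uniquely as functions vanishing off \<open>A\<close>.\<close>

definition seq_space :: "'a set \<Rightarrow> (('a \<Rightarrow> real) \<Rightarrow> ennreal) \<Rightarrow> ('a \<Rightarrow> real) nspace"
  where "seq_space A N =
    \<lparr>vecs = {x. (\<forall>j. j \<notin> A \<longrightarrow> x j = 0) \<and> N x < top}, vnorm = (\<lambda>x. enn2real (N x))\<rparr>"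

definition X_space ::
    "real \<Rightarrow> 'a set \<Rightarrow> 'a set set \<Rightarrow> ('a \<Rightarrow> real) \<Rightarrow> 'a set set \<Rightarrow> ('a \<Rightarrow> real) \<Rightarrow>
     ('a \<Rightarrow> real) nspace"
  where "X_space p A P1 w1 P2 w2 = seq_space A (X_enorm p A P1 w1 P2 w2)"

text \<open>For finite \<open>M\<close>, \<open>lp_space 2 M\<close> is all of \<open>\<real>\<^sup>M\<close> with the Euclidean norm.\<close>

definition lp_space :: "real \<Rightarrow> 'a set \<Rightarrow> ('a \<Rightarrow> real) nspace"
  where "lp_space p A = seq_space A (lp_enorm p A)"

abbreviation ell :: "real \<Rightarrow> (nat \<Rightarrow> real) nspace"
  where "ell p \<equiv> lp_space p UNIV"

definition lp_sum_enorm ::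
    "real \<Rightarrow> 'i set \<Rightarrow> ('i \<Rightarrow> 'v nspace) \<Rightarrow> ('i \<Rightarrow> 'v) \<Rightarrow> ennreal"
  where "lp_sum_enorm p I Y y = epowr (\<Sum>\<^sub>\<infinity>i\<in>I. ennreal (vnorm (Y i) (y i) powr p)) (1 / p)"

definition lp_sum ::
    "real \<Rightarrow> 'i set \<Rightarrow> ('i \<Rightarrow> 'v::real_vector nspace) \<Rightarrow> ('i \<Rightarrow> 'v) nspace"
  where "lp_sum p I Y =
    \<lparr>vecs = {y. (\<forall>i\<in>I. y i \<in> vecs (Y i)) \<and> (\<forall>i. i \<notin> I \<longrightarrow> y i = 0) \<and>
                lp_sum_enorm p I Y y < top},
     vnorm = (\<lambda>y. enn2real (lp_sum_enorm p I Y y))\<rparr>"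

text \<open>The direct sum of two spaces is determined up to isomorphism; the norm chosen here is the
  sum of the norms.\<close>

definition direct_sum ::
    "'v nspace \<Rightarrow> 'u nspace \<Rightarrow> ('v \<times> 'u) nspace" (infixr "\<oplus>\<^sub>B" 65)
  where "X \<oplus>\<^sub>B Y =
    \<lparr>vecs = vecs X \<times> vecs Y, vnorm = (\<lambda>(x, y). vnorm X x + vnorm Y y)\<rparr>"

end

theory Submission
  imports Defs
begin

text \<open>
  Write \<open>U\<^sub>P(x) = (\<Sum>\<^sub>M\<^sub>\<in>\<^sub>P (\<Sum>\<^sub>j\<^sub>\<in>\<^sub>M x\<^sub>j\<^sup>2)\<^sup>p\<^sup>/\<^sup>2)\<^sup>1\<^sup>/\<^sup>p\<close> for the unweighted norm of a partition
  \<open>P\<close> (\<open>block_enorm\<close>). Since \<open>t \<mapsto> t\<^sup>p\<^sup>/\<^sup>2\<close> is superadditive, \<open>U\<close> grows when the partition is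
  coarsened (\<open>block_sum_refine\<close>); the \<open>\<ell>\<^sub>p\<close> norm is the finest case, the \<open>\<ell>\<^sub>2\<close> norm the coarsest.
  Conversely, merging at most \<open>K\<close> blocks at a time costs only the power-mean factor
  \<open>K\<^sup>1\<^sup>/\<^sup>2\<^sup>-\<^sup>1\<^sup>/\<^sup>p\<close> (\<open>block_sum_coarsen\<close>). Weights that are bounded below cost a constant. So the norm of
  \<open>X\<close> is equivalent to \<open>U\<close> of the second partition in case (1), the first partition being finer, and
  to \<open>U\<close> of the first partition in case (2): in (2a) both lie between multiples of the \<open>\<ell>\<^sub>2\<close> norm, and in (2b)
  Hoelder's inequality bounds the term of the second partition by the \<open>\<ell>\<^sub>p\<close> norm
  (\<open>partition_enorm_summable_weights_le\<close>). For a finite partition \<open>U\<close> is equivalent to the \<open>\<ell>\<^sub>2\<close> norm.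
  What remains is to identify the space of \<open>U\<^sub>P\<close> from the sizes of the blocks.

  The substantial case is that of infinitely many finite blocks, where the answer is \<open>\<ell>\<^sub>p\<close>
  (\<open>linear_iso_finite_blocks_ell\<close>). The Rademacher functions on the cube of all subsets of a block
  \<open>M\<close> embed \<open>\<ell>\<^sub>2(M)\<close> into an \<open>\<ell>\<^sub>p\<close> space of dimension \<open>2\<^bsup>|M|\<^esup>\<close>; Khintchine's inequality bounds the
  embedding and Bessel's inequality, as \<open>p \<ge> 2\<close>, the orthogonal projection back, both independently
  of \<open>|M|\<close>. Hence the space of \<open>U\<^sub>P\<close> is complemented in \<open>\<ell>\<^sub>p\<close>. Pelczynski's
  decomposition method then applies in an explicit form: \<open>\<ell>\<^sub>p\<close> absorbs a complemented subspace
  \<open>Z\<close>, that is \<open>Z \<oplus> \<ell>\<^sub>p \<sim> \<ell>\<^sub>p\<close>, by moving \<open>Z\<close> into the first of infinitely many copies of \<open>\<ell>\<^sub>p\<close> and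
  shifting the component of type \<open>Z\<close> of each copy to the next one (\<open>linear_iso_absorb\<close>). The
  copy of \<open>\<ell>\<^sub>p\<close> that does the absorbing is found inside \<open>X\<close> itself: it is spanned by one
  coordinate from each block.

  If some but only finitely many of infinitely many blocks are infinite, their union carries a space isomorphic to
  \<open>\<ell>\<^sub>2\<close> and the union of the finite blocks one isomorphic to \<open>\<ell>\<^sub>p\<close>. If infinitely many blocks are
  infinite, each finite block can be merged with an infinite block of its own, which changes the
  norm by a bounded factor and leaves countably many infinite blocks, so \<open>(\<Sum> \<ell>\<^sub>2)\<^sub>\<ell>\<^sub>p\<close>.
\<close>

section \<open>Powers and sums in the extended nonnegative reals\<close>

lemma epowr_ennreal [simp]: "0 \<le> a \<Longrightarrow> epowr (ennreal a) r = ennreal (a powr r)"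
  by (simp add: epowr_def)

lemma epowr_top [simp]: "epowr top r = top"
  by (simp add: epowr_def)

lemma epowr_0 [simp]: "epowr 0 r = 0"
  by (simp add: epowr_def)

lemma epowr_1 [simp]: "epowr t 1 = t"
  by (cases t) (auto simp: epowr_def)

lemma epowr_less_top_iff [simp]: "epowr t r < top \<longleftrightarrow> t < top"
  by (cases t) (auto simp: epowr_def)

lemma epowr_mono:
  assumes "s \<le> t" "0 \<le> r" shows "epowr s r \<le> epowr t r"
  using assms by (cases s; cases t) (auto simp: top_unique intro!: ennreal_leI powr_mono2)

text \<open>With \<open>0 * \<infinity> = 0\<close> the power is multiplicative without exception, so that scalar factors pass
  through norms that may be infinite.\<close>

lemma epowr_mult: "epowr (s * t) r = epowr s r * epowr t r"
proof (cases s; cases t)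
  fix a b assume "0 \<le> a" "0 \<le> b" "s = ennreal a" "t = ennreal b"
  then show ?thesis
    by (simp add: powr_mult flip: ennreal_mult)
next
  fix a assume "0 \<le> a" "s = ennreal a" "t = top"
  then show ?thesis
    by (cases "a = 0") (auto simp: ennreal_mult_top)
next
  fix b assume "s = top" "0 \<le> b" "t = ennreal b"
  then show ?thesis
    by (cases "b = 0") (auto simp: ennreal_top_mult)
qed auto

lemma epowr_epowr [simp]: "epowr (epowr t r) q = epowr t (r * q)"
  by (cases t) (auto simp: powr_powr)

lemma ennreal_enn2real_powr: "t < top \<Longrightarrow> ennreal (enn2real t powr r) = epowr t r"
  by (simp add: epowr_def)

lemma epowr_scaled_le:
  assumes "s \<le> ennreal c * t" "0 \<le> c" "0 \<le> r"
  shows "epowr s r \<le> ennreal (c powr r) * epowr t r"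
  using epowr_mono[OF assms(1,3)] assms(2) by (simp add: epowr_mult)

text \<open>The crude constant comes from \<open>s + t \<le> 2 max s t\<close>; it replaces the triangle inequality
  throughout, where only equivalence of norms matters.\<close>

lemma epowr_add_le:
  assumes "0 \<le> r"
  shows "epowr (s + t) r \<le> ennreal (2 powr r) * (epowr s r + epowr t r)"
proof -
  have "s + t \<le> ennreal 2 * max s t"
    by (auto simp: mult_2 max_def intro: add_mono)
  then have "epowr (s + t) r \<le> ennreal (2 powr r) * epowr (max s t) r"
    by (rule epowr_scaled_le) (use assms in auto)
  also have "epowr (max s t) r \<le> epowr s r + epowr t r"
    by (auto simp: max_def)
  finally show ?thesis
    by (meson dual_order.trans mult_left_mono zero_le)
qed

lemma summable_on_ennreal_any [simp]: "(f :: 'a \<Rightarrow> ennreal) summable_on A"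
  by (rule nonneg_summable_on_complete) simp

lemma infsum_ennreal_eq_SUP:
  fixes f :: "'a \<Rightarrow> ennreal"
  shows "infsum f A = (SUP F\<in>{F. finite F \<and> F \<subseteq> A}. sum f F)"
  by (rule nonneg_infsum_complete) simp

lemma infsum_ennreal_mono:
  fixes f :: "'a \<Rightarrow> ennreal"
  assumes "\<And>i. i \<in> A \<Longrightarrow> f i \<le> g i"
  shows "infsum f A \<le> infsum g A"
  by (rule infsum_mono) (use assms in auto)

lemma infsum_ennreal_subset_mono:
  fixes f :: "'a \<Rightarrow> ennreal"
  assumes "A \<subseteq> B"
  shows "infsum f A \<le> infsum f B"
  by (rule infsum_mono_neutral) (use assms in auto)

lemma infsum_ennreal_cmult:
  fixes f :: "'a \<Rightarrow> ennreal"
  shows "(\<Sum>\<^sub>\<infinity>i\<in>A. c * f i) = c * infsum f A"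
  unfolding infsum_ennreal_eq_SUP
  by (subst SUP_mult_left_ennreal) (simp flip: sum_distrib_left)

lemma infsum_ennreal_add:
  fixes f :: "'a \<Rightarrow> ennreal"
  shows "(\<Sum>\<^sub>\<infinity>i\<in>A. f i + g i) = infsum f A + infsum g A"
  by (rule infsum_add) auto

text \<open>Tonelli's theorem for the counting measure: both sides are suprema of finite sums, and a finite
  subset of the disjoint union lies over a finite subset of \<open>I\<close>.\<close>

lemma infsum_ennreal_Sigma:
  fixes f :: "'a \<Rightarrow> 'b \<Rightarrow> ennreal"
  shows "(\<Sum>\<^sub>\<infinity>i\<in>I. \<Sum>\<^sub>\<infinity>k\<in>B i. f i k) = (\<Sum>\<^sub>\<infinity>(i,k)\<in>Sigma I B. f i k)"
proof (rule antisym)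
  have fin: "(\<Sum>i\<in>F. \<Sum>\<^sub>\<infinity>k\<in>B i. f i k) = (\<Sum>\<^sub>\<infinity>(i,k)\<in>Sigma F B. f i k)" if "finite F" for F
    using that
  proof (induction F)
    case (insert i F)
    have "Sigma (insert i F) B = Pair i ` B i \<union> Sigma F B"
      by auto
    then have "(\<Sum>\<^sub>\<infinity>(i,k)\<in>Sigma (insert i F) B. f i k)
        = (\<Sum>\<^sub>\<infinity>(i,k)\<in>Pair i ` B i. f i k) + (\<Sum>\<^sub>\<infinity>(i,k)\<in>Sigma F B. f i k)"
      using insert.hyps by (auto intro!: infsum_Un_disjoint)
    also have "(\<Sum>\<^sub>\<infinity>(i,k)\<in>Pair i ` B i. f i k) = (\<Sum>\<^sub>\<infinity>k\<in>B i. f i k)"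
      by (subst infsum_reindex) (auto simp: inj_on_def o_def)
    finally show ?case
      using insert by simp
  qed simp
  show "(\<Sum>\<^sub>\<infinity>i\<in>I. \<Sum>\<^sub>\<infinity>k\<in>B i. f i k) \<le> (\<Sum>\<^sub>\<infinity>(i,k)\<in>Sigma I B. f i k)"
    by (subst infsum_ennreal_eq_SUP, rule SUP_least)
      (auto simp: fin intro!: infsum_ennreal_subset_mono)
  show "(\<Sum>\<^sub>\<infinity>(i,k)\<in>Sigma I B. f i k) \<le> (\<Sum>\<^sub>\<infinity>i\<in>I. \<Sum>\<^sub>\<infinity>k\<in>B i. f i k)"
  proof (subst infsum_ennreal_eq_SUP, rule SUP_least)
    fix F assume "F \<in> {F. finite F \<and> F \<subseteq> Sigma I B}"
    then have F: "finite F" "F \<subseteq> Sigma I B"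
      by auto
    have "(\<Sum>(i,k)\<in>F. f i k) = (\<Sum>\<^sub>\<infinity>(i,k)\<in>F. f i k)"
      using F by simp
    also have "\<dots> \<le> (\<Sum>\<^sub>\<infinity>(i,k)\<in>Sigma (fst ` F) B. f i k)"
      using F by (intro infsum_ennreal_subset_mono) force
    also have "\<dots> = (\<Sum>\<^sub>\<infinity>i\<in>fst ` F. \<Sum>\<^sub>\<infinity>k\<in>B i. f i k)"
      using F by (simp add: fin)
    also have "\<dots> \<le> (\<Sum>\<^sub>\<infinity>i\<in>I. \<Sum>\<^sub>\<infinity>k\<in>B i. f i k)"
      using F by (intro infsum_ennreal_subset_mono) force
    finally show "(\<Sum>(i,k)\<in>F. f i k) \<le> (\<Sum>\<^sub>\<infinity>i\<in>I. \<Sum>\<^sub>\<infinity>k\<in>B i. f i k)" .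
  qed
qed

lemma infsum_ennreal_UN_disjoint:
  fixes f :: "'b \<Rightarrow> ennreal"
  assumes "disjoint_family_on B I"
  shows "(\<Sum>\<^sub>\<infinity>i\<in>I. \<Sum>\<^sub>\<infinity>k\<in>B i. f k) = (\<Sum>\<^sub>\<infinity>k\<in>(\<Union>i\<in>I. B i). f k)"
proof -
  have "inj_on snd (Sigma I B)"
    using assms by (force simp: inj_on_def disjoint_family_on_def)
  moreover have "snd ` Sigma I B = (\<Union>i\<in>I. B i)"
    by force
  ultimately have "(\<Sum>\<^sub>\<infinity>k\<in>(\<Union>i\<in>I. B i). f k) = (\<Sum>\<^sub>\<infinity>(i,k)\<in>Sigma I B. f k)"
    by (metis (no_types, lifting) infsum_reindex case_prod_unfold comp_apply infsum_cong)
  then show ?thesis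
    by (simp add: infsum_ennreal_Sigma)
qed

lemma infsum_ennreal_swap:
  fixes f :: "'a \<Rightarrow> 'b \<Rightarrow> ennreal"
  shows "(\<Sum>\<^sub>\<infinity>i\<in>I. \<Sum>\<^sub>\<infinity>k\<in>K. f i k) = (\<Sum>\<^sub>\<infinity>k\<in>K. \<Sum>\<^sub>\<infinity>i\<in>I. f i k)"
proof -
  have "(\<Sum>\<^sub>\<infinity>(i,k)\<in>I \<times> K. f i k) = (\<Sum>\<^sub>\<infinity>(k,i)\<in>K \<times> I. f i k)"
    by (rule infsum_reindex_bij_betw[of prod.swap, symmetric, THEN trans])
      (auto simp: bij_betw_def product_swap intro!: infsum_cong)
  then show ?thesis
    by (simp add: infsum_ennreal_Sigma)
qed

lemma member_le_infsum_ennreal: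
  fixes f :: "'a \<Rightarrow> ennreal"
  assumes "i \<in> A"
  shows "f i \<le> infsum f A"
  using infsum_ennreal_subset_mono[of "{i}" A f] assms by simp

text \<open>Each term factors as \<open>f\<^sub>i\<^sup>r = f\<^sub>i * f\<^sub>i\<^sup>r\<^sup>-\<^sup>1\<close>, and the second factor is at most the corresponding
  power of the whole sum.\<close>

lemma infsum_epowr_le_epowr_infsum:
  assumes "1 < r"
  shows "(\<Sum>\<^sub>\<infinity>i\<in>A. epowr (f i) r) \<le> epowr (infsum f A) r"
proof -
  have split: "epowr t r = t * epowr t (r - 1)" for t
  proof (cases t)
    case (real a)
    have "a powr r = a * a powr (r - 1)"
      using real(1) assms by (cases "a = 0") (auto simp: powr_diff)
    with real show ?thesis
      by (simp add: ennreal_mult)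
  qed simp
  have "(\<Sum>\<^sub>\<infinity>i\<in>A. epowr (f i) r) \<le> (\<Sum>\<^sub>\<infinity>i\<in>A. epowr (infsum f A) (r - 1) * f i)"
    by (subst split, intro infsum_ennreal_mono)
      (use assms in \<open>auto simp: mult.commute intro!: mult_left_mono epowr_mono member_le_infsum_ennreal\<close>)
  also have "\<dots> = epowr (infsum f A) (r - 1) * infsum f A"
    by (rule infsum_ennreal_cmult)
  also have "\<dots> = epowr (infsum f A) r"
    using split[of "infsum f A"] by (simp add: mult.commute)
  finally show ?thesis .
qed

text \<open>Jensen's inequality for \<open>t \<mapsto> t\<^sup>r\<close> on the positive terms; dropping the zeros decreases the factor
  \<open>(card F)\<^sup>r\<^sup>-\<^sup>1\<close> because \<open>r \<ge> 1\<close>.\<close>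

lemma power_mean_real:
  fixes s :: "'a \<Rightarrow> real"
  assumes "finite F" "\<And>i. i \<in> F \<Longrightarrow> 0 \<le> s i" "1 \<le> r"
  shows "(\<Sum>i\<in>F. s i) powr r \<le> real (card F) powr (r - 1) * (\<Sum>i\<in>F. s i powr r)"
proof -
  define G where "G = {i\<in>F. s i > 0}"
  have G: "finite G" "G \<subseteq> F"
    using assms by (auto simp: G_def)
  have sums: "(\<Sum>i\<in>F. s i) = (\<Sum>i\<in>G. s i)" "(\<Sum>i\<in>F. s i powr r) = (\<Sum>i\<in>G. s i powr r)"
    using assms by (auto simp: G_def intro!: sum.mono_neutral_right) (force simp: order.order_iff_strict)+
  show ?thesis
  proof (cases "G = {}")
    case False
    define n where "n = real (card G)"
    have n: "n > 0"
      using False G by (simp add: n_def card_gt_0_iff)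
    have "(\<Sum>i\<in>G. (1 / n) *\<^sub>R s i) powr r \<le> (\<Sum>i\<in>G. (1 / n) * s i powr r)"
      by (rule convex_on_sum[OF G(1) False powr_convex[OF assms(3)]])
        (use n in \<open>auto simp: G_def n_def\<close>)
    then have "((\<Sum>i\<in>G. s i) / n) powr r \<le> (\<Sum>i\<in>G. s i powr r) / n"
      by (simp flip: sum_distrib_left add: sum_divide_distrib)
    then have "n powr r * ((\<Sum>i\<in>G. s i) / n) powr r \<le> n powr r * ((\<Sum>i\<in>G. s i powr r) / n)"
      by (intro mult_left_mono) auto
    moreover have "n powr r * ((\<Sum>i\<in>G. s i) / n) powr r = (\<Sum>i\<in>G. s i) powr r"
      using n by (simp add: powr_divide)
    moreover have "n powr r * ((\<Sum>i\<in>G. s i powr r) / n) = n powr (r - 1) * (\<Sum>i\<in>G. s i powr r)"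
      using n by (simp add: powr_diff)
    ultimately have "(\<Sum>i\<in>G. s i) powr r \<le> n powr (r - 1) * (\<Sum>i\<in>G. s i powr r)"
      by simp
    also have "\<dots> \<le> real (card F) powr (r - 1) * (\<Sum>i\<in>G. s i powr r)"
      using assms G by (intro mult_right_mono powr_mono2) (auto simp: n_def card_mono sum_nonneg)
    finally show ?thesis
      by (simp add: sums)
  qed (simp add: sums)
qed

lemma power_mean_ennreal:
  assumes "finite F" "1 \<le> r"
  shows "epowr (\<Sum>i\<in>F. s i) r \<le> ennreal (real (card F) powr (r - 1)) * (\<Sum>i\<in>F. epowr (s i) r)"
proof (cases "\<exists>i\<in>F. s i = top")
  case True
  then have "(\<Sum>i\<in>F. epowr (s i) r) = top" "card F > 0"
    using assms by (auto simp: card_gt_0_iff epowr_def)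
  then show ?thesis
    by (simp add: ennreal_mult_top)
next
  case False
  then have s: "s i = ennreal (enn2real (s i))" if "i \<in> F" for i
    using that by (simp add: top.not_eq_extremum)
  have "(\<Sum>i\<in>F. s i) = (\<Sum>i\<in>F. ennreal (enn2real (s i)))"
    by (rule sum.cong[OF refl s])
  then have "(\<Sum>i\<in>F. s i) = ennreal (\<Sum>i\<in>F. enn2real (s i))"
    by simp
  moreover have "(\<Sum>i\<in>F. epowr (s i) r) = (\<Sum>i\<in>F. ennreal (enn2real (s i) powr r))"
    using False by (intro sum.cong refl) (simp add: epowr_def)
  then have "(\<Sum>i\<in>F. epowr (s i) r) = ennreal (\<Sum>i\<in>F. enn2real (s i) powr r)"
    by simp
  ultimately show ?thesis
    using power_mean_real[of F "\<lambda>i. enn2real (s i)" r] assms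
    by (simp add: sum_nonneg flip: ennreal_mult)
qed

section \<open>Isomorphisms given by global linear maps\<close>

text \<open>The maps are required to be linear on the whole ambient vector space and not only on the
  carriers. All isomorphisms below are of this kind, and linear images, sums and composites then need
  no side conditions on the carriers.\<close>

definition linear_iso :: "'v::real_vector nspace \<Rightarrow> 'u::real_vector nspace \<Rightarrow> bool"
  where "linear_iso X Y \<longleftrightarrow> (\<exists>T S. \<exists>C>0. linear T \<and> linear S \<and>
    (\<forall>x\<in>vecs X. T x \<in> vecs Y \<and> S (T x) = x \<and> vnorm Y (T x) \<le> C * vnorm X x) \<and>
    (\<forall>y\<in>vecs Y. S y \<in> vecs X \<and> T (S y) = y \<and> vnorm X (S y) \<le> C * vnorm Y y))"

lemma linear_iso_refl: "linear_iso X X"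
  unfolding linear_iso_def by (intro exI[of _ id] exI[of _ 1]) (auto simp: linear_id)

lemma linear_iso_sym: "linear_iso X Y \<Longrightarrow> linear_iso Y X"
  unfolding linear_iso_def by blast

lemma linear_iso_trans [trans]:
  assumes "linear_iso X Y" "linear_iso Y Z"
  shows "linear_iso X Z"
proof -
  obtain T S C where 1: "C > 0" "linear T" "linear S"
    "\<And>x. x \<in> vecs X \<Longrightarrow> T x \<in> vecs Y \<and> S (T x) = x \<and> vnorm Y (T x) \<le> C * vnorm X x"
    "\<And>y. y \<in> vecs Y \<Longrightarrow> S y \<in> vecs X \<and> T (S y) = y \<and> vnorm X (S y) \<le> C * vnorm Y y"
    using assms(1) unfolding linear_iso_def by blast
  obtain T' S' C' where 2: "C' > 0" "linear T'" "linear S'"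
    "\<And>x. x \<in> vecs Y \<Longrightarrow> T' x \<in> vecs Z \<and> S' (T' x) = x \<and> vnorm Z (T' x) \<le> C' * vnorm Y x"
    "\<And>y. y \<in> vecs Z \<Longrightarrow> S' y \<in> vecs Y \<and> T' (S' y) = y \<and> vnorm Y (S' y) \<le> C' * vnorm Z y"
    using assms(2) unfolding linear_iso_def by blast
  have bound1: "vnorm Z (T' (T x)) \<le> C * C' * vnorm X x" if "x \<in> vecs X" for x
  proof -
    have "vnorm Z (T' (T x)) \<le> C' * vnorm Y (T x)"
      using 1(4)[OF that] 2(4) by blast
    also have "\<dots> \<le> C' * (C * vnorm X x)"
      using 1(4)[OF that] 2(1) by (intro mult_left_mono) auto
    finally show ?thesis
      by (simp add: mult_ac)
  qed
  have bound2: "vnorm X (S (S' y)) \<le> C * C' * vnorm Z y" if "y \<in> vecs Z" for y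
  proof -
    have "vnorm X (S (S' y)) \<le> C * vnorm Y (S' y)"
      using 2(5)[OF that] 1(5) by blast
    also have "\<dots> \<le> C * (C' * vnorm Z y)"
      using 2(5)[OF that] 1(1) by (intro mult_left_mono) auto
    finally show ?thesis
      by (simp add: mult_ac)
  qed
  show ?thesis
    unfolding linear_iso_def
  proof (intro exI[of _ "T' \<circ> T"] exI[of _ "S \<circ> S'"] exI[of _ "C * C'"] conjI ballI)
    show "linear (T' \<circ> T)" "linear (S \<circ> S')"
      using 1 2 by (auto intro: linear_compose)
  qed (use 1 2 bound1 bound2 in simp_all)
qed

text \<open>Nonnegativity of the norms on the primed side follows from that on the other side by the bounds.\<close>

lemma linear_iso_direct_sum:
  assumes "linear_iso X X'" "linear_iso Y Y'"
    and nonneg: "\<And>x. x \<in> vecs X \<Longrightarrow> 0 \<le> vnorm X x" "\<And>y. y \<in> vecs Y \<Longrightarrow> 0 \<le> vnorm Y y"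
  shows "linear_iso (X \<oplus>\<^sub>B Y) (X' \<oplus>\<^sub>B Y')"
proof -
  obtain T S C where 1: "C > 0" "linear T" "linear S"
    "\<And>x. x \<in> vecs X \<Longrightarrow> T x \<in> vecs X' \<and> S (T x) = x \<and> vnorm X' (T x) \<le> C * vnorm X x"
    "\<And>y. y \<in> vecs X' \<Longrightarrow> S y \<in> vecs X \<and> T (S y) = y \<and> vnorm X (S y) \<le> C * vnorm X' y"
    using assms(1) unfolding linear_iso_def by blast
  obtain T' S' C' where 2: "C' > 0" "linear T'" "linear S'"
    "\<And>x. x \<in> vecs Y \<Longrightarrow> T' x \<in> vecs Y' \<and> S' (T' x) = x \<and> vnorm Y' (T' x) \<le> C' * vnorm Y x"
    "\<And>y. y \<in> vecs Y' \<Longrightarrow> S' y \<in> vecs Y \<and> T' (S' y) = y \<and> vnorm Y (S' y) \<le> C' * vnorm Y' y"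
    using assms(2) unfolding linear_iso_def by blast
  have nonneg': "0 \<le> vnorm X' y" if "y \<in> vecs X'" for y
    using 1(5)[OF that] nonneg(1)[of "S y"] 1(1)
    by (smt (verit) mult_pos_neg)
  have nonneg'': "0 \<le> vnorm Y' y" if "y \<in> vecs Y'" for y
    using 2(5)[OF that] nonneg(2)[of "S' y"] 2(1)
    by (smt (verit) mult_pos_neg)
  define D where "D = C + C'"
  have D: "a + b \<le> D * (a' + b')" if "a \<le> C * a'" "b \<le> C' * b'" "0 \<le> a'" "0 \<le> b'" for a b a' b'
  proof -
    have "0 \<le> C * b'" "0 \<le> C' * a'"
      using that 1(1) 2(1) by simp_all
    then show ?thesis
      using that by (simp add: D_def algebra_simps)
  qed
  have "linear (\<lambda>(x, y). (T x, T' y))" "linear (\<lambda>(x, y). (S x, S' y))"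
    using 1 2 by (auto intro!: linearI simp: linear_add linear_scale)
  moreover have "D > 0"
    using 1 2 by (simp add: D_def)
  ultimately show ?thesis
    unfolding linear_iso_def direct_sum_def
    by (intro exI[of _ "\<lambda>(x, y). (T x, T' y)"] exI[of _ "\<lambda>(x, y). (S x, S' y)"] exI[of _ D])
      (clarsimp, safe; (rule D)?; simp add: 1(4,5) 2(4,5) nonneg nonneg' nonneg'')
qed

text \<open>A linear map that is bounded on a subspace is continuous there, because differences stay in the
  subspace; the carrier of \<open>Y\<close> is a subspace as a linear image of that of \<open>X\<close>.\<close>

lemma linear_iso_imp_isomorphic:
  assumes "linear_iso X Y" "subspace (vecs X)"
  shows "X \<sim>\<^sub>B Y"
proof -
  obtain T S C where C: "C > 0" and lin: "linear T" "linear S"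
    and T: "\<And>x. x \<in> vecs X \<Longrightarrow> T x \<in> vecs Y \<and> S (T x) = x \<and> vnorm Y (T x) \<le> C * vnorm X x"
    and S: "\<And>y. y \<in> vecs Y \<Longrightarrow> S y \<in> vecs X \<and> T (S y) = y \<and> vnorm X (S y) \<le> C * vnorm Y y"
    using assms(1) unfolding linear_iso_def by blast
  have img: "T ` vecs X = vecs Y"
    using T S by force
  then have sub: "subspace (vecs Y)"
    using assms(2) lin(1) linear_subspace_image by metis
  have bij: "bij_betw T (vecs X) (vecs Y)"
    using T img by (metis bij_betw_imageI inj_on_inverseI)
  have inv: "inv_into (vecs X) T y = S y" if "y \<in> vecs Y" for y
    using that S T bij by (metis bij_betw_def inv_into_f_eq)
  have cont: "\<exists>d>0. \<forall>y\<in>V. nV (y - x) < d \<longrightarrow> nW (F y - F x) < e"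
    if "subspace V" "linear F" "x \<in> V" "\<And>x. x \<in> V \<Longrightarrow> nW (F x) \<le> C * nV x" "e > 0"
    for V and F :: "'x::real_vector \<Rightarrow> 'y::real_vector" and nV nW x e
  proof (intro exI[of _ "e / C"] conjI ballI impI)
    fix y assume "y \<in> V" "nV (y - x) < e / C"
    then have "nW (F (y - x)) \<le> C * nV (y - x)" "C * nV (y - x) < e"
      using that C by (auto simp: subspace_diff field_simps)
    then show "nW (F y - F x) < e"
      using that(2) by (simp add: linear_diff)
  qed (use C that in auto)
  have "nspace_continuous X Y T"
    unfolding nspace_continuous_def
    using cont[OF assms(2) lin(1)] T by auto
  moreover have "nspace_continuous Y X (inv_into (vecs X) T)"
    unfolding nspace_continuous_def
    using cont[OF sub lin(2), of _ "vnorm X" "vnorm Y"] S by (auto simp: inv)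
  moreover have "nspace_linear X Y T"
    unfolding nspace_linear_def using T lin by (auto simp: linear_add linear_scale)
  ultimately show ?thesis
    unfolding nspace_isomorphic_def using bij by blast
qed

text \<open>Every space considered here consists of those vectors of some linear set on which an extended
  norm is finite. For two such spaces, a single inequality between extended norms yields both that a map
  takes values in the target and that it is bounded.\<close>

definition finite_part :: "'v::real_vector set \<Rightarrow> ('v \<Rightarrow> ennreal) \<Rightarrow> 'v nspace"
  where "finite_part V N = \<lparr>vecs = {x\<in>V. N x < top}, vnorm = (\<lambda>x. enn2real (N x))\<rparr>"

abbreviation supported :: "'a set \<Rightarrow> ('a \<Rightarrow> 'b::zero) set"
  where "supported A \<equiv> {x. \<forall>j. j \<notin> A \<longrightarrow> x j = 0}"

lemma seq_space_eq_finite_part: "seq_space A N = finite_part (supported A) N"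
  by (simp add: seq_space_def finite_part_def)

text \<open>Equality of the two spaces fails only off the carriers, where the real-valued norms of infinite
  vectors are junk.\<close>

lemma direct_sum_finite_part:
  "linear_iso (finite_part (V \<times> W) (\<lambda>(x, y). N x + M y)) (finite_part V N \<oplus>\<^sub>B finite_part W M)"
  unfolding linear_iso_def
  by (intro exI[of _ id] exI[of _ 1])
    (auto simp: direct_sum_def finite_part_def enn2real_plus linear_id)

lemma linear_iso_finite_partI:
  assumes "linear T" "linear S" "c > 0"
    and T: "\<And>x. x \<in> V \<Longrightarrow> N x < top \<Longrightarrow> T x \<in> W \<and> S (T x) = x \<and> M (T x) \<le> ennreal c * N x"
    and S: "\<And>y. y \<in> W \<Longrightarrow> M y < top \<Longrightarrow> S y \<in> V \<and> T (S y) = y \<and> N (S y) \<le> ennreal c * M y"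
  shows "linear_iso (finite_part V N) (finite_part W M)"
proof -
  have *: "K < top \<and> enn2real K \<le> c * enn2real L" if "K \<le> ennreal c * L" "L < top" for K L
  proof -
    have "ennreal c * L < top"
      using that(2) by (simp add: ennreal_mult_less_top)
    then show ?thesis
      using that enn2real_mono[OF that(1)] \<open>c > 0\<close> by (auto simp: enn2real_mult)
  qed
  have "M (T x) < top \<and> enn2real (M (T x)) \<le> c * enn2real (N x)" if "x \<in> V" "N x < top" for x
    using T[OF that] that *[of "M (T x)" "N x"] by blast
  moreover have "N (S y) < top \<and> enn2real (N (S y)) \<le> c * enn2real (M y)" if "y \<in> W" "M y < top" for y
    using S[OF that] that *[of "N (S y)" "M y"] by blast
  ultimately show ?thesis
    unfolding linear_iso_def finite_part_def
    by (intro exI[of _ T] exI[of _ S] exI[of _ c]) (simp add: assms(1-3) T S)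
qed

lemma linear_iso_seq_space_cong:
  assumes "\<And>x. x \<in> supported A \<Longrightarrow> N x = N' x"
  shows "linear_iso (seq_space A N) (seq_space A N')"
  unfolding seq_space_eq_finite_part
  by (rule linear_iso_finite_partI[of id id 1]) (simp_all add: assms linear_id)

lemma linear_iso_direct_sum_seq:
  assumes "linear_iso (seq_space A N) X'" "linear_iso (seq_space B M) Y'"
  shows "linear_iso (seq_space A N \<oplus>\<^sub>B seq_space B M) (X' \<oplus>\<^sub>B Y')"
  using assms by (rule linear_iso_direct_sum) (simp_all add: seq_space_def)

lemma enorm_equivalentI:
  assumes "0 < c" "0 < C" "\<And>x. ennreal c * M x \<le> N x" "\<And>x. N x \<le> ennreal C * M x"
  shows "enorm_equivalent N M"
proof -
  have 1: "ennreal (1 / C) * N x \<le> M x" for x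
  proof -
    have "ennreal (1 / C) * N x \<le> ennreal (1 / C) * (ennreal C * M x)"
      by (intro mult_left_mono assms) auto
    then show ?thesis
      using assms(2) by (simp add: mult.assoc[symmetric] flip: ennreal_mult)
  qed
  have 2: "M x \<le> ennreal (1 / c) * N x" for x
  proof -
    have "ennreal (1 / c) * (ennreal c * M x) \<le> ennreal (1 / c) * N x"
      by (intro mult_left_mono assms) auto
    then show ?thesis
      using assms(1) by (simp add: mult.assoc[symmetric] flip: ennreal_mult)
  qed
  have "\<exists>D>0. \<forall>x. ennreal (1 / C) * N x \<le> M x \<and> M x \<le> ennreal D * N x"
    using assms(1) 1 2 by (intro exI[of _ "1 / c"]) simp
  then show ?thesis
    unfolding enorm_equivalent_def using assms(2) by (intro exI[of _ "1 / C"]) simp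
qed

lemma linear_iso_enorm_equivalent:
  assumes "enorm_equivalent N N'"
  shows "linear_iso (seq_space A N) (seq_space A N')"
proof -
  obtain c C where cC: "c > 0" "C > 0"
    and le: "\<And>x. ennreal c * N x \<le> N' x" "\<And>x. N' x \<le> ennreal C * N x"
    using assms unfolding enorm_equivalent_def by blast
  have 1: "N' x \<le> ennreal (max (1 / c) C) * N x" for x
    by (rule order_trans[OF le(2)], rule mult_right_mono) (auto intro: ennreal_leI)
  have 2: "N x \<le> ennreal (max (1 / c) C) * N' x" for x
  proof -
    have "N x = ennreal (1 / c) * (ennreal c * N x)"
      using cC by (simp add: mult.assoc[symmetric] flip: ennreal_mult)
    also have "\<dots> \<le> ennreal (max (1 / c) C) * N' x"
      by (rule mult_mono) (auto intro: ennreal_leI le)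
    finally show ?thesis .
  qed
  show ?thesis
    unfolding seq_space_eq_finite_part
    by (rule linear_iso_finite_partI[of id id "max (1 / c) C"])
      (simp_all add: 1 2 cC less_max_iff_disj linear_id)
qed

section \<open>Partitions\<close>

definition block_of :: "'a set set \<Rightarrow> 'a \<Rightarrow> 'a set"
  where "block_of P j = (THE M. M \<in> P \<and> j \<in> M)"

lemma block_of_eq:
  assumes "partition_on A P" "M \<in> P" "j \<in> M"
  shows "block_of P j = M"
  unfolding block_of_def
  by (rule the_equality) (use assms in \<open>auto simp: partition_on_def disjoint_def\<close>)

lemma block_of_mem:
  assumes "partition_on A P" "j \<in> A"
  shows "block_of P j \<in> P" "j \<in> block_of P j"
proof -
  obtain M where "M \<in> P" "j \<in> M"
    using assms by (auto simp: partition_on_def)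
  then show "block_of P j \<in> P" "j \<in> block_of P j"
    using block_of_eq[OF assms(1)] by auto
qed

lemma countable_partition:
  assumes "countable A" "partition_on A P"
  shows "countable P"
proof -
  have "M \<in> block_of P ` A" if "M \<in> P" for M
  proof -
    have "M \<subseteq> A" "M \<noteq> {}"
      using that assms(2) by (auto simp: partition_on_def)
    then obtain j where "j \<in> M" "j \<in> A"
      by blast
    then show ?thesis
      using block_of_eq[OF assms(2) that] by blast
  qed
  then show ?thesis
    using assms(1) by (meson countable_image countable_subset subsetI)
qed

abbreviation singletons :: "'a set \<Rightarrow> 'a set set"
  where "singletons A \<equiv> (\<lambda>j. {j}) ` A"

lemma partition_on_singletons: "partition_on A (singletons A)"
  by (auto simp: partition_on_def disjoint_def)

lemma partition_on_trivial: "A \<noteq> {} \<Longrightarrow> partition_on A {A}"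
  by (auto simp: partition_on_def disjoint_def)

text \<open>If \<open>P\<close> refines \<open>Q\<close>, then the blocks of \<open>Q\<close> partition both the underlying set and, by the subsets
  they contain, the family \<open>P\<close>. This is what allows sums over \<open>P\<close> to be grouped along \<open>Q\<close>.\<close>

lemma partition_on_group:
  assumes P: "partition_on A P" and Q: "partition_on A Q" and ref: "\<forall>N\<in>P. \<exists>M\<in>Q. N \<subseteq> M"
  shows "disjoint_family_on (\<lambda>M. {N\<in>P. N \<subseteq> M}) Q" "(\<Union>M\<in>Q. {N\<in>P. N \<subseteq> M}) = P"
    and "M \<in> Q \<Longrightarrow> \<Union>{N\<in>P. N \<subseteq> M} = M"
    and "disjoint_family_on id {N\<in>P. N \<subseteq> M}"
proof -
  have eq: "M = M'" if "M \<in> Q" "M' \<in> Q" "j \<in> M" "j \<in> M'" for M M' j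
    using Q that by (auto simp: partition_on_def disjoint_def)
  have eqP: "M = M'" if "M \<in> P" "M' \<in> P" "j \<in> M" "j \<in> M'" for M M' j
    using P that by (auto simp: partition_on_def disjoint_def)
  show "disjoint_family_on (\<lambda>M. {N\<in>P. N \<subseteq> M}) Q"
    unfolding disjoint_family_on_def
  proof (intro ballI impI equals0I)
    fix M M' N assume "M \<in> Q" "M' \<in> Q" "M \<noteq> M'" "N \<in> {N\<in>P. N \<subseteq> M} \<inter> {N\<in>P. N \<subseteq> M'}"
    moreover from this have "N \<noteq> {}"
      using P by (auto simp: partition_on_def)
    ultimately show False
      using eq[of M M'] by blast
  qed
  show "(\<Union>M\<in>Q. {N\<in>P. N \<subseteq> M}) = P"
    using ref by blast
  show "\<Union>{N\<in>P. N \<subseteq> M} = M" if "M \<in> Q"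
  proof (intro equalityI subsetI)
    fix j assume "j \<in> M"
    moreover have "j \<in> \<Union>P"
      using \<open>j \<in> M\<close> P Q that by (auto simp: partition_on_def)
    then obtain N where N: "N \<in> P" "j \<in> N"
      by blast
    moreover obtain M' where "M' \<in> Q" "N \<subseteq> M'"
      using ref N by blast
    ultimately show "j \<in> \<Union>{N\<in>P. N \<subseteq> M}"
      using eq[of M M' j] that by blast
  qed blast
  show "disjoint_family_on id {N\<in>P. N \<subseteq> M}"
    unfolding disjoint_family_on_def using eqP by auto
qed

lemma subfamily_partition:
  assumes "partition_on A P" "P0 \<subseteq> P"
  shows "partition_on (\<Union>P0) P0" "(\<inter>) (\<Union>P0) ` P - {{}} = P0"
proof -
  show "partition_on (\<Union>P0) P0"
    using assms by (auto simp: partition_on_def intro: pairwise_subset)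
  have disj: "M \<inter> N = {}" if "M \<in> P" "N \<in> P" "M \<noteq> N" for M N
    using assms(1) that by (auto simp: partition_on_def disjoint_def)
  have 1: "\<Union>P0 \<inter> M = M" if "M \<in> P0" for M
    using that by auto
  have 2: "\<Union>P0 \<inter> M = {}" if "M \<in> P" "M \<notin> P0" for M
  proof -
    have "N \<inter> M = {}" if "N \<in> P0" for N
      using that \<open>M \<in> P\<close> \<open>M \<notin> P0\<close> assms(2) by (intro disj) auto
    then show ?thesis
      by blast
  qed
  have "{} \<notin> P0"
    using assms by (auto simp: partition_on_def)
  show "(\<inter>) (\<Union>P0) ` P - {{}} = P0"
  proof (intro equalityI subsetI)
    fix K assume "K \<in> (\<inter>) (\<Union>P0) ` P - {{}}"
    then obtain M where M: "M \<in> P" "K = \<Union>P0 \<inter> M" "K \<noteq> {}"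
      by blast
    then have "M \<in> P0"
      using 2[of M] by argo
    then show "K \<in> P0"
      using 1[of M] M(2) by simp
  next
    fix K assume K: "K \<in> P0"
    then have "K \<in> (\<inter>) (\<Union>P0) ` P"
      using assms(2) by (intro image_eqI[where x = K] 1[symmetric]) auto
    moreover have "K \<noteq> {}"
      using K \<open>{} \<notin> P0\<close> by metis
    ultimately show "K \<in> (\<inter>) (\<Union>P0) ` P - {{}}"
      by simp
  qed
qed

section \<open>Block norms\<close>

text \<open>The \<open>p\<close>-th power of the norm \<open>block_enorm\<close>, on which the estimates are additive in the blocks.\<close>

definition block_sum :: "real \<Rightarrow> 'a set set \<Rightarrow> ('a \<Rightarrow> real) \<Rightarrow> ennreal"
  where "block_sum p P x = (\<Sum>\<^sub>\<infinity>M\<in>P. epowr (\<Sum>\<^sub>\<infinity>j\<in>M. ennreal ((x j)\<^sup>2)) (p / 2))"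

definition block_enorm :: "real \<Rightarrow> 'a set set \<Rightarrow> ('a \<Rightarrow> real) \<Rightarrow> ennreal"
  where "block_enorm p P x = epowr (block_sum p P x) (1 / p)"

lemma block_enorm_less_top_iff [simp]: "block_enorm p P x < top \<longleftrightarrow> block_sum p P x < top"
  by (simp add: block_enorm_def)

lemma partition_enorm_eq_block_enorm: "partition_enorm p P w x = block_enorm p P (\<lambda>j. x j * w j)"
  by (simp add: partition_enorm_def block_enorm_def block_sum_def power_mult_distrib)

lemma block_sum_singletons: "block_sum p (singletons A) x = (\<Sum>\<^sub>\<infinity>j\<in>A. ennreal (\<bar>x j\<bar> powr p))"
proof -
  have "(x j)\<^sup>2 powr (p / 2) = \<bar>x j\<bar> powr p" for j
  proof -
    have "(x j)\<^sup>2 = \<bar>x j\<bar> powr 2"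
      by simp
    then show ?thesis
      by (simp only: powr_powr) simp
  qed
  then show ?thesis
    by (simp add: block_sum_def infsum_reindex inj_on_def o_def)
qed

text \<open>The \<open>\<ell>\<^sub>p\<close> and \<open>\<ell>\<^sub>2\<close> norms are the block norms of the finest and of the coarsest partition, so that
  facts on block norms cover them as well.\<close>

lemma lp_enorm_eq_block_enorm: "lp_enorm p A = block_enorm p (singletons A)"
  by (simp add: fun_eq_iff lp_enorm_def block_enorm_def block_sum_singletons)

lemma l2_enorm_eq_block_enorm: "0 < p \<Longrightarrow> lp_enorm 2 A = block_enorm p {A}"
  by (simp add: fun_eq_iff lp_enorm_def block_enorm_def block_sum_def)

lemma lp_space_eq: "lp_space p A = seq_space A (block_enorm p (singletons A))"
  by (simp add: lp_space_def lp_enorm_eq_block_enorm)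

lemma l2_space_eq: "0 < p \<Longrightarrow> lp_space 2 A = seq_space A (block_enorm p {A})"
  by (simp add: lp_space_def l2_enorm_eq_block_enorm)

lemma block_sum_mono:
  assumes "\<And>M j. M \<in> P \<Longrightarrow> j \<in> M \<Longrightarrow> \<bar>x j\<bar> \<le> \<bar>y j\<bar>" "0 \<le> p"
  shows "block_sum p P x \<le> block_sum p P y"
  unfolding block_sum_def
  by (intro infsum_ennreal_mono epowr_mono ennreal_leI)
    (use assms in \<open>auto simp: abs_le_square_iff\<close>)

lemma block_sum_cong:
  assumes "\<And>M j. M \<in> P \<Longrightarrow> j \<in> M \<Longrightarrow> x j = y j"
  shows "block_sum p P x = block_sum p P y"
  unfolding block_sum_def using assms by (intro infsum_cong arg_cong2[where f = epowr]) auto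

lemma block_sum_zero [simp]: "block_sum p P (\<lambda>j. 0) = 0"
  by (simp add: block_sum_def)

lemma block_sum_scale: "block_sum p P (\<lambda>j. c * x j) = ennreal (\<bar>c\<bar> powr p) * block_sum p P x"
proof -
  have "c\<^sup>2 powr (p / 2) = \<bar>c\<bar> powr p"
  proof -
    have "c\<^sup>2 = \<bar>c\<bar> powr 2"
      by simp
    then show ?thesis
      by (simp only: powr_powr) simp
  qed
  then show ?thesis
    by (simp add: block_sum_def power_mult_distrib ennreal_mult infsum_ennreal_cmult epowr_mult)
qed

text \<open>From \<open>(a + b)\<^sup>2 \<le> 2 (a\<^sup>2 + b\<^sup>2)\<close> in each block; the factor \<open>2\<close> and the one of \<open>epowr_add_le\<close> both
  contribute \<open>2\<^sup>p\<^sup>/\<^sup>2\<close>.\<close>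

lemma block_sum_add:
  assumes "0 \<le> p"
  shows "block_sum p P (\<lambda>j. x j + y j) \<le> ennreal (2 powr p) * (block_sum p P x + block_sum p P y)"
proof -
  let ?s = "\<lambda>x M. \<Sum>\<^sub>\<infinity>j\<in>M. ennreal ((x j)\<^sup>2)"
  have "?s (\<lambda>j. x j + y j) M \<le> ennreal 2 * (?s x M + ?s y M)" for M
  proof -
    have "?s (\<lambda>j. x j + y j) M \<le> (\<Sum>\<^sub>\<infinity>j\<in>M. ennreal 2 * (ennreal ((x j)\<^sup>2) + ennreal ((y j)\<^sup>2)))"
    proof (intro infsum_ennreal_mono)
      fix j
      have "(x j + y j)\<^sup>2 \<le> 2 * ((x j)\<^sup>2 + (y j)\<^sup>2)"
        using zero_le_power2[of "x j - y j"] by (simp add: power2_eq_square algebra_simps)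
      then show "ennreal ((x j + y j)\<^sup>2) \<le> ennreal 2 * (ennreal ((x j)\<^sup>2) + ennreal ((y j)\<^sup>2))"
        by (simp flip: ennreal_plus ennreal_mult del: ennreal_numeral add: ennreal_leI)
    qed
    then show ?thesis
      by (simp only: infsum_ennreal_cmult infsum_ennreal_add)
  qed
  then have "epowr (?s (\<lambda>j. x j + y j) M) (p / 2) \<le> ennreal (2 powr (p / 2)) * epowr (?s x M + ?s y M) (p / 2)" for M
    by (rule epowr_scaled_le) (use assms in auto)
  also have "\<dots> M \<le> ennreal (2 powr (p / 2)) * (ennreal (2 powr (p / 2)) * (epowr (?s x M) (p / 2) + epowr (?s y M) (p / 2)))" for M
    using assms by (intro mult_left_mono epowr_add_le) auto
  also have "\<dots> M = ennreal (2 powr p) * (epowr (?s x M) (p / 2) + epowr (?s y M) (p / 2))" for M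
    by (simp add: mult.assoc[symmetric] flip: ennreal_mult powr_add)
  finally have "block_sum p P (\<lambda>j. x j + y j)
      \<le> (\<Sum>\<^sub>\<infinity>M\<in>P. ennreal (2 powr p) * (epowr (?s x M) (p / 2) + epowr (?s y M) (p / 2)))"
    unfolding block_sum_def by (intro infsum_ennreal_mono)
  then show ?thesis
    by (simp only: block_sum_def infsum_ennreal_cmult infsum_ennreal_add)
qed

lemma subspace_block_space:
  assumes "0 \<le> p"
  shows "subspace (vecs (seq_space A (block_enorm p P)))"
proof (rule subspaceI)
  show "0 \<in> vecs (seq_space A (block_enorm p P))"
    by (simp add: seq_space_def zero_fun_def)
next
  fix x y assume "x \<in> vecs (seq_space A (block_enorm p P))" "y \<in> vecs (seq_space A (block_enorm p P))"
  then show "x + y \<in> vecs (seq_space A (block_enorm p P))"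
    using order.strict_trans1[OF block_sum_add[OF assms, of P x y]]
    by (auto simp: seq_space_def plus_fun_def ennreal_mult_less_top)
next
  fix c x assume "x \<in> vecs (seq_space A (block_enorm p P))"
  then show "c *\<^sub>R x \<in> vecs (seq_space A (block_enorm p P))"
    by (auto simp: seq_space_def scaleR_fun_def block_sum_scale ennreal_mult_less_top)
qed

lemma block_enorm_le:
  assumes "block_sum p P x \<le> ennreal c * block_sum q Q y" "0 \<le> c" "0 < p" "p = q"
  shows "block_enorm p P x \<le> ennreal (c powr (1 / p)) * block_enorm q Q y"
  using epowr_scaled_le[OF assms(1,2), of "1 / p"] assms(3,4) by (simp add: block_enorm_def)

lemma block_enorm_mono:
  assumes "block_sum p P x \<le> block_sum p Q y" "0 < p"
  shows "block_enorm p P x \<le> block_enorm p Q y"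
  unfolding block_enorm_def using assms by (intro epowr_mono) auto

lemma block_enorm_scale: "0 < p \<Longrightarrow> block_enorm p P (\<lambda>j. c * x j) = ennreal \<bar>c\<bar> * block_enorm p P x"
  by (simp add: block_enorm_def block_sum_scale epowr_mult powr_powr)

lemma block_enorm_add:
  assumes "0 < p"
  shows "block_enorm p P (u + v) \<le> ennreal (2 * 2 powr (1 / p)) * (block_enorm p P u + block_enorm p P v)"
proof -
  have "block_enorm p P (u + v) \<le> ennreal ((2 powr p) powr (1 / p)) * epowr (block_sum p P u + block_sum p P v) (1 / p)"
    unfolding block_enorm_def plus_fun_def
    by (rule epowr_scaled_le[OF block_sum_add]) (use assms in auto)
  also have "\<dots> \<le> ennreal 2 * (ennreal (2 powr (1 / p)) * (block_enorm p P u + block_enorm p P v))"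
    unfolding block_enorm_def by (rule mult_mono) (use assms in \<open>auto simp: powr_powr intro!: epowr_add_le\<close>)
  also have "\<dots> = ennreal (2 * 2 powr (1 / p)) * (block_enorm p P u + block_enorm p P v)"
    by (simp add: ennreal_mult mult.assoc)
  finally show ?thesis .
qed

text \<open>Superadditivity of \<open>t \<mapsto> t\<^sup>p\<^sup>/\<^sup>2\<close> inside each block of the coarser partition.\<close>

lemma block_sum_refine:
  assumes "2 < p" "partition_on A P" "partition_on A Q" "\<forall>N\<in>P. \<exists>M\<in>Q. N \<subseteq> M"
  shows "block_sum p P x \<le> block_sum p Q x"
proof -
  note G = partition_on_group[OF assms(2-4)]
  let ?s = "\<lambda>M. \<Sum>\<^sub>\<infinity>j\<in>M. ennreal ((x j)\<^sup>2)"
  have "block_sum p P x = (\<Sum>\<^sub>\<infinity>M\<in>Q. \<Sum>\<^sub>\<infinity>N\<in>{N\<in>P. N \<subseteq> M}. epowr (?s N) (p / 2))"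
    unfolding block_sum_def by (simp only: infsum_ennreal_UN_disjoint[OF G(1)] G(2))
  also have "\<dots> \<le> (\<Sum>\<^sub>\<infinity>M\<in>Q. epowr (\<Sum>\<^sub>\<infinity>N\<in>{N\<in>P. N \<subseteq> M}. ?s N) (p / 2))"
    using assms(1) by (intro infsum_ennreal_mono infsum_epowr_le_epowr_infsum) auto
  also have "\<dots> = block_sum p Q x"
    unfolding block_sum_def
  proof (intro infsum_cong arg_cong2[where f = epowr] refl)
    fix M assume "M \<in> Q"
    then show "(\<Sum>\<^sub>\<infinity>N\<in>{N\<in>P. N \<subseteq> M}. ?s N) = ?s M"
      using infsum_ennreal_UN_disjoint[OF G(4)[of M], of "\<lambda>j. ennreal ((x j)\<^sup>2)"] G(3)
      by simp
  qed
  finally show ?thesis .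
qed

text \<open>The power-mean inequality inside each block of the coarser partition. The constant is the sharp
  one, which the two-sided estimates for finite partitions need.\<close>

lemma block_sum_coarsen:
  assumes "2 < p" "partition_on A P" "partition_on A Q" "\<forall>N\<in>P. \<exists>M\<in>Q. N \<subseteq> M"
    and K: "\<And>M. M \<in> Q \<Longrightarrow> finite {N\<in>P. N \<subseteq> M} \<and> card {N\<in>P. N \<subseteq> M} \<le> K"
  shows "block_sum p Q x \<le> ennreal (real K powr (p / 2 - 1)) * block_sum p P x"
proof -
  note G = partition_on_group[OF assms(2-4)]
  let ?s = "\<lambda>M. \<Sum>\<^sub>\<infinity>j\<in>M. ennreal ((x j)\<^sup>2)"
  have "block_sum p Q x = (\<Sum>\<^sub>\<infinity>M\<in>Q. epowr (\<Sum>\<^sub>\<infinity>N\<in>{N\<in>P. N \<subseteq> M}. ?s N) (p / 2))"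
    unfolding block_sum_def
  proof (intro infsum_cong arg_cong2[where f = epowr] refl)
    fix M assume "M \<in> Q"
    then show "?s M = (\<Sum>\<^sub>\<infinity>N\<in>{N\<in>P. N \<subseteq> M}. ?s N)"
      using infsum_ennreal_UN_disjoint[OF G(4)[of M], of "\<lambda>j. ennreal ((x j)\<^sup>2)"] G(3)
      by simp
  qed
  also have "\<dots> \<le> (\<Sum>\<^sub>\<infinity>M\<in>Q. ennreal (real K powr (p / 2 - 1)) * (\<Sum>\<^sub>\<infinity>N\<in>{N\<in>P. N \<subseteq> M}. epowr (?s N) (p / 2)))"
  proof (intro infsum_ennreal_mono)
    fix M assume "M \<in> Q"
    define F where "F = {N\<in>P. N \<subseteq> M}"
    have F: "finite F" "card F \<le> K"
      using K[OF \<open>M \<in> Q\<close>] by (auto simp: F_def)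
    have "epowr (\<Sum>N\<in>F. ?s N) (p / 2) \<le> ennreal (real (card F) powr (p / 2 - 1)) * (\<Sum>N\<in>F. epowr (?s N) (p / 2))"
      using assms(1) F by (intro power_mean_ennreal) auto
    also have "\<dots> \<le> ennreal (real K powr (p / 2 - 1)) * (\<Sum>N\<in>F. epowr (?s N) (p / 2))"
      using assms(1) F by (intro mult_right_mono ennreal_leI powr_mono2) auto
    finally show "epowr (\<Sum>\<^sub>\<infinity>N\<in>F. ?s N) (p / 2) \<le> ennreal (real K powr (p / 2 - 1)) * (\<Sum>\<^sub>\<infinity>N\<in>F. epowr (?s N) (p / 2))"
      using F by simp
  qed
  also have "\<dots> = ennreal (real K powr (p / 2 - 1)) * block_sum p P x"
    unfolding block_sum_def by (simp only: infsum_ennreal_cmult infsum_ennreal_UN_disjoint[OF G(1)] G(2))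
  finally show ?thesis .
qed

text \<open>On vectors supported in \<open>D\<close>, a block \<open>M\<close> is seen only through \<open>M \<inter> D\<close>.\<close>

lemma block_sum_restrict:
  assumes "partition_on A P" "x \<in> supported D"
  shows "block_sum p P x = block_sum p ((\<inter>) D ` P - {{}}) x"
proof -
  let ?s = "\<lambda>M. \<Sum>\<^sub>\<infinity>j\<in>M. ennreal ((x j)\<^sup>2)"
  define P' where "P' = {M\<in>P. D \<inter> M \<noteq> {}}"
  have inj: "inj_on ((\<inter>) D) P'"
  proof (rule inj_onI)
    fix M N assume MN: "M \<in> P'" "N \<in> P'" "D \<inter> M = D \<inter> N"
    then obtain j where "j \<in> M \<inter> N"
      by (auto simp: P'_def)
    then show "M = N"
      using MN assms(1) by (auto simp: P'_def partition_on_def disjoint_def)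
  qed
  have s: "?s M = ?s (D \<inter> M)" for M
    by (rule infsum_cong_neutral) (use assms(2) in auto)
  have "block_sum p P x = (\<Sum>\<^sub>\<infinity>M\<in>P'. epowr (?s (D \<inter> M)) (p / 2))"
    unfolding block_sum_def
  proof (rule infsum_cong_neutral)
    fix M assume "M \<in> P - P'"
    then have "D \<inter> M = {}"
      by (auto simp: P'_def)
    then show "epowr (?s M) (p / 2) = 0"
      using s[of M] by simp
  qed (use s in \<open>auto simp: P'_def\<close>)
  also have "\<dots> = block_sum p ((\<inter>) D ` P') x"
    unfolding block_sum_def by (subst infsum_reindex[OF inj]) (simp add: o_def)
  also have "(\<inter>) D ` P' = (\<inter>) D ` P - {{}}"
    by (auto simp: P'_def)
  finally show ?thesis .
qed

lemma block_sum_reindex: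
  assumes "inj_on \<phi> A" "partition_on A P"
  shows "block_sum p ((`) \<phi> ` P) y = block_sum p P (y \<circ> \<phi>)"
proof -
  have sub: "M \<subseteq> A" if "M \<in> P" for M
    using that assms(2) by (auto simp: partition_on_def)
  have "inj_on ((`) \<phi>) P"
    using inj_on_image_eq_iff[OF assms(1)] sub by (auto intro: inj_onI)
  then show ?thesis
    unfolding block_sum_def
    by (subst infsum_reindex)
      (auto simp: o_def intro!: infsum_cong arg_cong2[where f = epowr]
        infsum_reindex[OF inj_on_subset[OF assms(1) sub], unfolded o_def])
qed

lemma linear_iso_reindex:
  assumes \<phi>: "bij_betw \<phi> A B" and P: "partition_on A P" and "0 < p"
  shows "linear_iso (seq_space A (block_enorm p P)) (seq_space B (block_enorm p ((`) \<phi> ` P)))"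
proof -
  define T S where "T = (\<lambda>x k. if k \<in> B then x (inv_into A \<phi> k) else 0 :: real)"
    and "S = (\<lambda>y j. if j \<in> A then y (\<phi> j) else 0 :: real)"
  have sub: "M \<subseteq> A" if "M \<in> P" for M
    using that P by (auto simp: partition_on_def)
  have inj: "inj_on \<phi> A"
    using \<phi> by (simp add: bij_betw_def)
  have lin: "linear T" "linear S"
    by (auto intro!: linearI simp: T_def S_def fun_eq_iff scaleR_fun_def)
  have T: "block_enorm p ((`) \<phi> ` P) (T x) = block_enorm p P x" for x
    unfolding block_enorm_def block_sum_reindex[OF inj P]
    by (rule arg_cong2[where f = epowr], rule block_sum_cong)
      (use sub \<phi> in \<open>auto simp: T_def bij_betw_apply inv_into_f_f[OF inj] subset_iff\<close>)
  have S: "block_enorm p P (S y) = block_enorm p ((`) \<phi> ` P) y" for y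
    unfolding block_enorm_def block_sum_reindex[OF inj P]
    by (rule arg_cong2[where f = epowr], rule block_sum_cong)
      (use sub in \<open>auto simp: S_def subset_iff\<close>)
  have ST: "S (T x) = x" if "x \<in> supported A" for x
    using that \<phi> by (auto simp: fun_eq_iff S_def T_def bij_betw_apply inv_into_f_f[OF inj])
  have TS: "T (S y) = y" if "y \<in> supported B" for y
    using that \<phi> by (auto simp: fun_eq_iff S_def T_def bij_betw_inv_into_right bij_betw_def inv_into_into f_inv_into_f)
  show ?thesis
    unfolding seq_space_eq_finite_part
    by (rule linear_iso_finite_partI[OF lin zero_less_one])
      (use S T ST TS in \<open>auto simp: T_def S_def\<close>)
qed

lemma linear_iso_lp_space_reindex:
  assumes "bij_betw \<phi> A B" "0 < p"
  shows "linear_iso (lp_space p A) (lp_space p B)"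
proof -
  have "(`) \<phi> ` singletons A = singletons B"
    using assms(1) by (auto simp: bij_betw_def)
  then show ?thesis
    using linear_iso_reindex[OF assms(1) partition_on_singletons assms(2)]
    by (simp add: lp_space_eq)
qed

lemma linear_iso_lp_space_countable:
  assumes "countable A" "infinite A" "countable B" "infinite B" "0 < p"
  shows "linear_iso (lp_space p A) (lp_space p B)"
proof -
  have "bij_betw (from_nat_into B \<circ> to_nat_on A) A B"
    using assms by (intro bij_betw_trans[OF to_nat_on_infinite bij_betw_from_nat_into])
  then show ?thesis
    using linear_iso_lp_space_reindex assms(5) by blast
qed

lemma linear_iso_ell2:
  assumes "0 < p" "countable A" "infinite A"
  shows "linear_iso (seq_space A (block_enorm p {A})) (ell 2)"
  using linear_iso_lp_space_countable[of A "UNIV :: nat set" 2] assms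
  by (simp add: l2_space_eq[OF assms(1)])

lemma linear_iso_subfamily:
  assumes "partition_on A P" "P0 \<subseteq> P"
  shows "linear_iso (seq_space (\<Union>P0) (block_enorm p P)) (seq_space (\<Union>P0) (block_enorm p P0))"
proof (rule linear_iso_seq_space_cong)
  fix x :: "'a \<Rightarrow> real" assume "x \<in> supported (\<Union>P0)"
  from block_sum_restrict[OF assms(1) this, of p]
  show "block_enorm p P x = block_enorm p P0 x"
    unfolding block_enorm_def subfamily_partition(2)[OF assms] by simp
qed

text \<open>Restriction to a set of coordinates is a projection of norm at most one, because block norms
  are monotone in the absolute values of the coordinates; so any splitting of the index set splits the space.\<close>

lemma linear_iso_split:
  assumes "0 < p" and disj: "A \<inter> B = {}"
  shows "linear_iso (seq_space (A \<union> B) (block_enorm p P))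
           (seq_space A (block_enorm p P) \<oplus>\<^sub>B seq_space B (block_enorm p P))"
proof -
  let ?N = "block_enorm p P"
  define r where "r = (\<lambda>D (x :: 'a \<Rightarrow> real) j. if j \<in> D then x j else 0)"
  define T where "T = (\<lambda>x. (r A x, r B x))"
  define S where "S = (\<lambda>(u :: 'a \<Rightarrow> real, v). u + v)"
  define c where "c = 2 * 2 powr (1 / p)"
  have lin: "linear T" "linear S"
    by (auto intro!: linearI simp: T_def S_def r_def fun_eq_iff scaleR_fun_def algebra_simps)
  have r: "?N (r D x) \<le> ?N x" for D x
    unfolding block_enorm_def using assms(1)
    by (intro epowr_mono block_sum_mono) (auto simp: r_def)
  have c: "2 \<le> c"
    using assms(1) ge_one_powr_ge_zero[of 2 "1 / p"] by (simp add: c_def)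
  have T: "?N (r A x) + ?N (r B x) \<le> ennreal c * ?N x" for x
  proof -
    have "?N (r A x) + ?N (r B x) \<le> ennreal 2 * ?N x"
      by (simp add: mult_2 add_mono r)
    also have "\<dots> \<le> ennreal c * ?N x"
      using c by (intro mult_right_mono ennreal_leI) auto
    finally show ?thesis .
  qed
  have S: "?N (u + v) \<le> ennreal c * (?N u + ?N v)" for u v
    unfolding c_def by (rule block_enorm_add[OF assms(1)])
  have "linear_iso (finite_part (supported (A \<union> B)) ?N)
      (finite_part (supported A \<times> supported B) (\<lambda>(u, v). ?N u + ?N v))"
  proof (rule linear_iso_finite_partI[OF lin, of c])
    fix x assume "x \<in> supported (A \<union> B)" "?N x < top"
    moreover have "S (T x) = x"
      using calculation disj by (auto simp: fun_eq_iff S_def T_def r_def)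
    ultimately show "T x \<in> supported A \<times> supported B \<and> S (T x) = x \<and>
        (case T x of (u, v) \<Rightarrow> ?N u + ?N v) \<le> ennreal c * ?N x"
      using T[of x] by (auto simp: T_def r_def)
  next
    fix y assume "y \<in> supported A \<times> supported B" "(case y of (u, v) \<Rightarrow> ?N u + ?N v) < top"
    moreover have "T (S y) = y"
      using calculation disj by (cases y) (force simp: fun_eq_iff S_def T_def r_def)
    ultimately show "S y \<in> supported (A \<union> B) \<and> T (S y) = y \<and>
        ?N (S y) \<le> ennreal c * (case y of (u, v) \<Rightarrow> ?N u + ?N v)"
      using S by (cases y) (auto simp: S_def)
  qed (use c in simp)
  also note direct_sum_finite_part
  finally show ?thesis
    by (simp only: seq_space_eq_finite_part)
qed

section \<open>Rademacher functions on a finite cube\<close>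

text \<open>The cube \<open>{-1, 1}\<^sup>M\<close> is encoded as the power set of \<open>M\<close>: a subset is the set of coordinates
  with value \<open>1\<close>.\<close>

definition rademacher :: "'a \<Rightarrow> 'a set \<Rightarrow> real"
  where "rademacher j S = (if j \<in> S then 1 else - 1)"

lemma rademacher_square [simp]: "rademacher j S * rademacher j S = 1"
  by (simp add: rademacher_def)

text \<open>Independence of the Rademacher functions, in the form of a factorisation of the exponential
  moment.\<close>

lemma sum_Pow_exp_rademacher:
  assumes "finite M"
  shows "(\<Sum>S\<in>Pow M. exp (\<Sum>j\<in>M. rademacher j S * a j)) = (\<Prod>j\<in>M. exp (a j) + exp (- a j))"
  using assms
proof (induction M)
  case (insert i M)
  let ?f = "\<lambda>S. exp (\<Sum>j\<in>M. rademacher j S * a j)"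
  have off: "(\<Sum>j\<in>M. rademacher j (insert i S) * a j) = (\<Sum>j\<in>M. rademacher j S * a j)" for S
    using insert.hyps by (intro sum.cong) (auto simp: rademacher_def)
  have "inj_on (insert i) (Pow M)"
    using insert.hyps by (auto simp: inj_on_def)
  then have "(\<Sum>S\<in>Pow (insert i M). exp (\<Sum>j\<in>insert i M. rademacher j S * a j))
      = (\<Sum>S\<in>Pow M. exp (\<Sum>j\<in>insert i M. rademacher j S * a j))
        + (\<Sum>S\<in>Pow M. exp (\<Sum>j\<in>insert i M. rademacher j (insert i S) * a j))"
    using insert.hyps
    by (subst Pow_insert, subst sum.union_disjoint) (auto simp: sum.reindex)
  also have "(\<Sum>S\<in>Pow M. exp (\<Sum>j\<in>insert i M. rademacher j (insert i S) * a j)) = (\<Sum>S\<in>Pow M. exp (a i) * ?f S)"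
    using insert.hyps off by (simp add: rademacher_def[of i] exp_add)
  also have "(\<Sum>S\<in>Pow M. exp (\<Sum>j\<in>insert i M. rademacher j S * a j)) = (\<Sum>S\<in>Pow M. exp (- a i) * ?f S)"
  proof (intro sum.cong refl)
    fix S assume "S \<in> Pow M"
    then have "rademacher i S = - 1"
      using insert.hyps by (auto simp: rademacher_def)
    then show "exp (\<Sum>j\<in>insert i M. rademacher j S * a j) = exp (- a i) * ?f S"
      using insert.hyps by (simp add: exp_diff exp_minus field_simps)
  qed
  finally show ?case
    using insert by (simp add: algebra_simps flip: sum_distrib_left)
qed simp

lemma exp_add_exp_minus_le:
  fixes a :: real
  assumes "\<bar>a\<bar> \<le> 1"
  shows "exp a + exp (- a) \<le> 2 * exp (a\<^sup>2)"
proof -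
  have *: "exp b + exp (- b) \<le> 2 * exp (b\<^sup>2)" if "0 \<le> b" "b \<le> 1" for b :: real
  proof -
    \<comment> \<open>Together with \<open>exp b \<le> 1 + b + b\<^sup>2\<close> this makes the linear terms cancel.\<close>
    have "exp (- b) \<le> 1 / (1 + b)"
      using that exp_ge_add_one_self[of b] by (simp add: exp_minus field_simps)
    also have "\<dots> \<le> 1 - b + b\<^sup>2"
      using that by (simp add: field_simps power2_eq_square)
    finally have "exp b + exp (- b) \<le> 2 * (1 + b\<^sup>2)"
      using exp_bound[OF that] by simp
    also have "\<dots> \<le> 2 * exp (b\<^sup>2)"
      by (intro mult_left_mono exp_ge_add_one_self) auto
    finally show ?thesis .
  qed
  show ?thesis
    using *[of a] *[of "- a"] assms by (cases "0 \<le> a") (auto simp: add.commute)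
qed

lemma powr_le_exp:
  fixes t :: real
  assumes "0 \<le> t" "0 < p"
  shows "t powr p \<le> p powr p * exp t"
proof -
  have "t / p \<le> exp (t / p)"
    using exp_ge_add_one_self[of "t / p"] by linarith
  then have "(t / p) powr p \<le> exp (t / p) powr p"
    using assms by (intro powr_mono2) auto
  also have "\<dots> = exp t"
    using assms by (simp add: powr_def)
  finally show ?thesis
    using assms by (simp add: powr_divide field_simps)
qed

text \<open>The constant of Khintchine's inequality below. It does not depend on the number of variables,
  which makes the embeddings of blocks of all sizes uniformly bounded.\<close>

definition khintchine :: "real \<Rightarrow> real"
  where "khintchine p = 2 * p powr p * exp 1"

text \<open>Normalise \<open>x\<close> to Euclidean norm \<open>1\<close>. Then \<open>|t|\<^sup>p \<le> p\<^sup>p exp |t| \<le> p\<^sup>p (exp t + exp (-t))\<close>, and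
  the exponential moments factor into terms at most \<open>2 exp (a\<^sub>j\<^sup>2)\<close>, whose product is \<open>2\<^bsup>|M|\<^esup> exp 1\<close>.\<close>

lemma khintchine_upper:
  assumes M: "finite M" and p: "0 < p"
  shows "(\<Sum>S\<in>Pow M. \<bar>\<Sum>j\<in>M. rademacher j S * x j\<bar> powr p)
    \<le> 2 ^ card M * (khintchine p * (\<Sum>j\<in>M. (x j)\<^sup>2) powr (p / 2))"
proof (cases "(\<Sum>j\<in>M. (x j)\<^sup>2) = 0")
  case True
  then have "x j = 0" if "j \<in> M" for j
    using M that by (simp add: sum_nonneg_eq_0_iff)
  then have "(\<Sum>j\<in>M. rademacher j S * x j) = 0" for S
    by simp
  then show ?thesis
    using True by simp
next
  case False
  define V where "V = (\<Sum>j\<in>M. (x j)\<^sup>2)"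
  have V: "V > 0"
    using False sum_nonneg[of M "\<lambda>j. (x j)\<^sup>2"] by (simp add: V_def order.order_iff_strict)
  define a where "a = (\<lambda>j. x j / sqrt V)"
  have a2: "(\<Sum>j\<in>M. (a j)\<^sup>2) = 1"
    using V by (simp add: a_def power_divide flip: sum_divide_distrib V_def)
  have a1: "\<bar>a j\<bar> \<le> 1" if "j \<in> M" for j
  proof -
    have "(a j)\<^sup>2 \<le> (\<Sum>j\<in>M. (a j)\<^sup>2)"
      using M that by (intro member_le_sum) auto
    then show ?thesis
      by (simp add: a2 abs_square_le_1)
  qed
  let ?r = "\<lambda>S. \<Sum>j\<in>M. rademacher j S * a j"
  have r_neg: "(\<Sum>j\<in>M. rademacher j S * - a j) = - ?r S" for S
    by (simp add: sum_negf)
  have x: "(\<Sum>j\<in>M. rademacher j S * x j) = sqrt V * ?r S" for S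
    using V by (simp add: sum_distrib_left a_def)
  have "(\<Prod>j\<in>M. exp (a j) + exp (- a j)) \<le> (\<Prod>j\<in>M. 2 * exp ((a j)\<^sup>2))"
    by (intro prod_mono conjI exp_add_exp_minus_le a1) (auto intro: add_nonneg_nonneg)
  also have "\<dots> = 2 ^ card M * exp 1"
    using M by (simp add: prod.distrib a2 flip: exp_sum)
  finally have prod: "(\<Prod>j\<in>M. exp (a j) + exp (- a j)) \<le> 2 ^ card M * exp 1" .
  have "(\<Sum>S\<in>Pow M. \<bar>?r S\<bar> powr p) \<le> (\<Sum>S\<in>Pow M. p powr p * (exp (?r S) + exp (- ?r S)))"
  proof (intro sum_mono)
    fix S
    have "\<bar>?r S\<bar> powr p \<le> p powr p * exp \<bar>?r S\<bar>"
      using p by (intro powr_le_exp) auto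
    also have "\<dots> \<le> p powr p * (exp (?r S) + exp (- ?r S))"
      by (intro mult_left_mono) (auto simp: abs_if)
    finally show "\<bar>?r S\<bar> powr p \<le> p powr p * (exp (?r S) + exp (- ?r S))" .
  qed
  also have "\<dots> = p powr p * (2 * (\<Prod>j\<in>M. exp (a j) + exp (- a j)))"
    using sum_Pow_exp_rademacher[OF M, of a] sum_Pow_exp_rademacher[OF M, of "\<lambda>j. - a j"]
    unfolding r_neg by (simp add: sum.distrib add.commute flip: sum_distrib_left)
  also have "\<dots> \<le> p powr p * (2 * (2 ^ card M * exp 1))"
    by (intro mult_left_mono prod) auto
  finally have "(\<Sum>S\<in>Pow M. \<bar>?r S\<bar> powr p) \<le> 2 ^ card M * khintchine p"
    by (simp add: khintchine_def mult_ac)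
  then have le: "V powr (p / 2) * (\<Sum>S\<in>Pow M. \<bar>?r S\<bar> powr p) \<le> V powr (p / 2) * (2 ^ card M * khintchine p)"
    by (intro mult_left_mono) auto
  have "\<bar>sqrt V * t\<bar> powr p = V powr (p / 2) * \<bar>t\<bar> powr p" for t
    using V by (simp add: abs_mult powr_mult powr_half_sqrt[symmetric] powr_powr)
  then have "(\<Sum>S\<in>Pow M. \<bar>\<Sum>j\<in>M. rademacher j S * x j\<bar> powr p)
      = V powr (p / 2) * (\<Sum>S\<in>Pow M. \<bar>?r S\<bar> powr p)"
    by (simp only: x sum_distrib_left[symmetric])
  also note le
  also have "V powr (p / 2) * (2 ^ card M * khintchine p) = 2 ^ card M * (khintchine p * V powr (p / 2))"
    by simp
  finally show ?thesis
    by (simp only: V_def)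
qed

text \<open>Flipping the coordinate \<open>i\<close> is an involution of the cube that changes the sign of the summand.\<close>

lemma rademacher_orthogonal:
  assumes "finite M" "i \<in> M" "i \<noteq> j"
  shows "(\<Sum>S\<in>Pow M. rademacher i S * rademacher j S) = 0"
proof -
  let ?flip = "\<lambda>S. if i \<in> S then S - {i} else insert i S"
  have "(\<Sum>S\<in>Pow M. rademacher i S * rademacher j S)
      = (\<Sum>S\<in>Pow M. - (rademacher i S * rademacher j S))"
    by (rule sum.reindex_bij_witness[of _ ?flip ?flip])
      (use assms in \<open>auto simp: rademacher_def\<close>)
  then show ?thesis
    by (simp add: sum_negf)
qed

lemma sum_Pow_rademacher:
  assumes "finite M" "i \<in> M"
  shows "(\<Sum>S\<in>Pow M. rademacher i S * rademacher j S) = (if i = j then 2 ^ card M else 0)"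
  using rademacher_orthogonal[OF assms, of j] assms(1) by (auto simp: card_Pow)

lemma rademacher_coefficient:
  assumes "finite M" "i \<in> M"
  shows "(\<Sum>S\<in>Pow M. rademacher i S * (\<Sum>j\<in>M. rademacher j S * x j)) = 2 ^ card M * x i"
proof -
  have "(\<Sum>S\<in>Pow M. rademacher i S * (\<Sum>j\<in>M. rademacher j S * x j))
      = (\<Sum>j\<in>M. (\<Sum>S\<in>Pow M. rademacher i S * rademacher j S) * x j)"
    unfolding sum_distrib_left sum_distrib_right by (subst sum.swap) (simp add: mult_ac)
  also have "\<dots> = (\<Sum>j\<in>M. if i = j then 2 ^ card M * x j else 0)"
    by (intro sum.cong refl) (simp add: sum_Pow_rademacher[OF assms])
  finally show ?thesis
    using assms by simp
qed

text \<open>Bessel's inequality for the orthogonal functions \<open>r\<^sub>j\<close>, all of squared norm \<open>2\<^bsup>|M|\<^esup>\<close>: expand the square of the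
  distance from \<open>f\<close> to its orthogonal projection.\<close>

lemma rademacher_bessel:
  assumes M: "finite M"
  shows "(\<Sum>j\<in>M. (\<Sum>S\<in>Pow M. rademacher j S * f S)\<^sup>2) \<le> 2 ^ card M * (\<Sum>S\<in>Pow M. (f S)\<^sup>2)"
proof -
  define n :: real where "n = 2 ^ card M"
  define c where "c = (\<lambda>j. \<Sum>S\<in>Pow M. rademacher j S * f S)"
  define g where "g = (\<lambda>S. \<Sum>j\<in>M. rademacher j S * c j)"
  have fg: "(\<Sum>S\<in>Pow M. f S * g S) = (\<Sum>j\<in>M. (c j)\<^sup>2)"
  proof -
    have "(\<Sum>S\<in>Pow M. f S * g S) = (\<Sum>j\<in>M. \<Sum>S\<in>Pow M. rademacher j S * f S * c j)"
      unfolding g_def sum_distrib_left by (subst sum.swap) (simp add: mult_ac)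
    then show ?thesis
      by (simp add: c_def power2_eq_square sum_distrib_right)
  qed
  have gg: "(\<Sum>S\<in>Pow M. (g S)\<^sup>2) = n * (\<Sum>j\<in>M. (c j)\<^sup>2)"
  proof -
    have "(\<Sum>S\<in>Pow M. (g S)\<^sup>2) = (\<Sum>j\<in>M. c j * (\<Sum>S\<in>Pow M. rademacher j S * g S))"
      unfolding power2_eq_square
      by (subst (1) g_def, subst sum_distrib_right, subst sum.swap) (simp add: sum_distrib_left mult_ac)
    also have "\<dots> = (\<Sum>j\<in>M. c j * (n * c j))"
      unfolding g_def n_def by (intro sum.cong refl) (simp add: rademacher_coefficient[OF M])
    finally show ?thesis
      by (simp add: sum_distrib_left power2_eq_square mult_ac)
  qed
  \<comment> \<open>\<open>g\<close> is \<open>n\<close> times the orthogonal projection of \<open>f\<close>.\<close>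
  have "0 \<le> (\<Sum>S\<in>Pow M. (n * f S - g S)\<^sup>2)"
    by (intro sum_nonneg) auto
  also have "\<dots> = (\<Sum>S\<in>Pow M. n * n * (f S)\<^sup>2 - 2 * n * (f S * g S) + (g S)\<^sup>2)"
    by (intro sum.cong refl) (simp add: power2_eq_square algebra_simps)
  also have "\<dots> = n * n * (\<Sum>S\<in>Pow M. (f S)\<^sup>2) - n * (\<Sum>j\<in>M. (c j)\<^sup>2)"
    by (simp add: sum.distrib sum_subtractf fg gg flip: sum_distrib_left)
  finally have "n * (\<Sum>j\<in>M. (c j)\<^sup>2) \<le> n * (n * (\<Sum>S\<in>Pow M. (f S)\<^sup>2))"
    by simp
  moreover have "n > 0"
    by (simp add: n_def)
  ultimately show ?thesis
    by (simp add: n_def c_def)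
qed

text \<open>Bessel's inequality followed by the power-mean inequality, which for \<open>p \<ge> 2\<close> passes from \<open>\<ell>\<^sub>2\<close> to
  \<open>\<ell>\<^sub>p\<close> on the cube. The power of \<open>2\<^bsup>|M|\<^esup>\<close> is exactly the one that the normalisation of
  \<open>rademacher_project\<close> cancels.\<close>

lemma rademacher_projection_bound:
  assumes M: "finite M" and p: "2 \<le> p"
  shows "(\<Sum>j\<in>M. (\<Sum>S\<in>Pow M. rademacher j S * f S)\<^sup>2) powr (p / 2)
    \<le> (2 ^ card M) powr (p - 1) * (\<Sum>S\<in>Pow M. \<bar>f S\<bar> powr p)"
proof -
  define n :: real where "n = 2 ^ card M"
  have n: "n > 0" "real (card (Pow M)) = n"
    using M by (simp_all add: n_def card_Pow)
  have "(\<Sum>j\<in>M. (\<Sum>S\<in>Pow M. rademacher j S * f S)\<^sup>2) powr (p / 2)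
      \<le> (n * (\<Sum>S\<in>Pow M. (f S)\<^sup>2)) powr (p / 2)"
    using rademacher_bessel[OF M, of f] p by (intro powr_mono2) (auto simp: n_def intro: sum_nonneg)
  also have "\<dots> = n powr (p / 2) * (\<Sum>S\<in>Pow M. (f S)\<^sup>2) powr (p / 2)"
    using n by (simp add: powr_mult sum_nonneg)
  also have "\<dots> \<le> n powr (p / 2) * (n powr (p / 2 - 1) * (\<Sum>S\<in>Pow M. (f S)\<^sup>2 powr (p / 2)))"
    using power_mean_real[of "Pow M" "\<lambda>S. (f S)\<^sup>2" "p / 2"] M p n(2) by (intro mult_left_mono) auto
  also have "\<dots> = n powr (p - 1) * (\<Sum>S\<in>Pow M. (f S)\<^sup>2 powr (p / 2))"
    by (simp add: mult.assoc[symmetric] flip: powr_add)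
  also have "(\<lambda>S. (f S)\<^sup>2 powr (p / 2)) = (\<lambda>S. \<bar>f S\<bar> powr p)"
  proof
    fix S show "(f S)\<^sup>2 powr (p / 2) = \<bar>f S\<bar> powr p"
      using powr_powr[of "\<bar>f S\<bar>" 2 "p / 2"] by simp
  qed
  finally show ?thesis
    by (simp add: n_def)
qed

section \<open>Absorbing a complemented subspace into \<open>\<ell>\<^sub>p\<close>\<close>

lemma infsum_nat_eq_0_plus_Suc:
  fixes h :: "nat \<Rightarrow> ennreal"
  shows "(\<Sum>\<^sub>\<infinity>i\<in>UNIV. h i) = h 0 + (\<Sum>\<^sub>\<infinity>i\<in>UNIV. h (Suc i))"
proof -
  have "(\<Sum>\<^sub>\<infinity>i\<in>UNIV. h i) = (\<Sum>\<^sub>\<infinity>i\<in>{0} \<union> range Suc. h i)"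
    by (metis UNIV_nat_eq insert_is_Un)
  also have "\<dots> = h 0 + (\<Sum>\<^sub>\<infinity>i\<in>range Suc. h i)"
    by (subst infsum_Un_disjoint) auto
  finally show ?thesis
    by (simp add: infsum_reindex o_def)
qed

definition slice :: "('b \<times> nat \<Rightarrow> real) \<Rightarrow> nat \<Rightarrow> 'b \<Rightarrow> real"
  where "slice f i = (\<lambda>b. f (b, i))"

lemma block_sum_singletons_Times:
  "block_sum p (singletons (B \<times> UNIV)) f = (\<Sum>\<^sub>\<infinity>i\<in>UNIV. block_sum p (singletons B) (slice f i))"
  unfolding block_sum_singletons slice_def
  by (subst infsum_ennreal_swap) (simp add: infsum_ennreal_Sigma case_prod_unfold)

text \<open>Let \<open>Z\<close> be the space of the vectors supported in \<open>D\<close>. Since \<open>Q J\<close> is the identity on \<open>Z\<close>, the map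
  \<open>E = J Q\<close> is a projection of \<open>\<ell>\<^sub>p(B)\<close> onto a copy of \<open>Z\<close>. An element \<open>f\<close> of \<open>\<ell>\<^sub>p(B \<times> \<nat>)\<close> is a sequence of slices \<open>f\<^sub>i\<close> in
  \<open>\<ell>\<^sub>p(B)\<close>, each the sum of \<open>E f\<^sub>i\<close> and \<open>f\<^sub>i - E f\<^sub>i\<close>. The isomorphism keeps the parts \<open>f\<^sub>i - E f\<^sub>i\<close> in
  place, moves \<open>E f\<^sub>i\<close> to slice \<open>i + 1\<close> and puts \<open>J x\<close> into the vacated place in slice \<open>0\<close>; its
  inverse shifts back. This is Pelczynski's decomposition method with the isomorphism written out.\<close>

lemma linear_iso_absorb:
  fixes J :: "('a \<Rightarrow> real) \<Rightarrow> 'b \<Rightarrow> real" and Q :: "('b \<Rightarrow> real) \<Rightarrow> 'a \<Rightarrow> real"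
  assumes p: "0 < p" and c: "0 \<le> c" and lin: "linear J" "linear Q"
    and J: "\<And>x. J x \<in> supported B" "\<And>x. block_sum p (singletons B) (J x) \<le> ennreal c * block_sum p P x"
    and Q: "\<And>f. Q f \<in> supported D" "\<And>f. block_sum p P (Q f) \<le> ennreal c * block_sum p (singletons B) f"
    and QJ: "\<And>x. x \<in> supported D \<Longrightarrow> Q (J x) = x"
  shows "linear_iso (seq_space D (block_enorm p P) \<oplus>\<^sub>B lp_space p (B \<times> (UNIV :: nat set)))
           (lp_space p (B \<times> (UNIV :: nat set)))"
proof -
  let ?G = "block_sum p (singletons B)" and ?X = "block_sum p P"
    and ?H = "block_sum p (singletons (B \<times> (UNIV :: nat set)))"
  define E where "E = (\<lambda>f. J (Q f))"
  \<comment> \<open>Slice \<open>i\<close> of \<open>T (x, f)\<close> keeps \<open>f\<^sub>i - E f\<^sub>i\<close> and receives \<open>E f\<^sub>i\<^sub>-\<^sub>1\<close>, or \<open>J x\<close> if \<open>i = 0\<close>.\<close>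
  define T where "T = (\<lambda>(x, f) (b, i). (case i of 0 \<Rightarrow> J x | Suc k \<Rightarrow> E (slice f k)) b
      + (slice f i - E (slice f i)) b)"
  define S where "S = (\<lambda>g. (Q (slice g 0),
      \<lambda>(b, i). E (slice g (Suc i)) b + (slice g i - E (slice g i)) b))"
  \<comment> \<open>With \<open>G\<close> for the \<open>\<ell>\<^sub>p\<close> sum: \<open>G (E f) \<le> c\<^sup>2 G f\<close> and hence \<open>G (f - E f) \<le> a G f\<close>. The first term of \<open>C\<close> bounds
    the slices, the summand \<open>c\<close> the component \<open>Q g\<^sub>0\<close> of the inverse.\<close>
  define a where "a = 2 powr p * (1 + c * c)"
  define C where "C = 2 powr p * (c + c * c + a) + c"
  have pos: "0 < a" "0 < C" "c \<le> C" "2 powr p * (c + c * c + a) \<le> C"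
  proof -
    show a: "0 < a"
      using c by (simp add: a_def add_pos_nonneg)
    have "0 < 2 powr p * (c + c * c + a)"
      using c a by (intro mult_pos_pos add_nonneg_pos) auto
    then show "0 < C" "c \<le> C"
      using c unfolding C_def by linarith+
  qed (use c in \<open>simp add: C_def\<close>)
  have linE: "linear E"
    using linear_compose[OF lin(2,1)] by (simp add: E_def o_def)
  have slice_lin: "slice (f + g) i = slice f i + slice g i" "slice (t *\<^sub>R f) i = t *\<^sub>R slice f i"
    for f g :: "'b \<times> nat \<Rightarrow> real" and t i
    by (simp_all add: slice_def fun_eq_iff scaleR_fun_def)
  have scaleR_apply: "(t *\<^sub>R f) b = t * f b" for t and f :: "'x \<Rightarrow> real" and b
    by (simp add: scaleR_fun_def)
  have linT: "linear T"
    by (rule linearI)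
      (auto simp: T_def fun_eq_iff slice_lin linear_add[OF linE] linear_scale[OF linE]
        linear_add[OF lin(1)] linear_scale[OF lin(1)] scaleR_apply algebra_simps split: nat.split)
  have linS: "linear S"
    by (rule linearI)
      (auto simp: S_def fun_eq_iff slice_lin linear_add[OF linE] linear_scale[OF linE]
        linear_add[OF lin(2)] linear_scale[OF lin(2)] scaleR_apply algebra_simps)
  have EJ: "E (J x) = J x" if "x \<in> supported D" for x
    using QJ that by (simp add: E_def)
  have EE: "E (E f) = E f" for f
    by (simp add: E_def QJ[OF Q(1)])
  have QE: "Q (E f) = Q f" for f
    by (simp add: E_def QJ[OF Q(1)])
  have E0: "E (f - E f) = 0" "Q (f - E f) = 0" for f
    by (simp_all add: linear_diff[OF linE] linear_diff[OF lin(2)] EE QE)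
  have slice_T: "slice (T (x, f)) i = (case i of 0 \<Rightarrow> J x | Suc k \<Rightarrow> E (slice f k)) + (slice f i - E (slice f i))" for x f i
    by (simp add: slice_def T_def fun_eq_iff)
  have slice_S: "slice (snd (S g)) i = E (slice g (Suc i)) + (slice g i - E (slice g i))" for g i
    by (simp add: slice_def S_def fun_eq_iff)
  have slice_eqI: "f = g" if "\<And>i. slice f i = slice g i" for f g :: "'b \<times> nat \<Rightarrow> real"
    using that by (force simp: slice_def fun_eq_iff)
  have ST: "S (T (x, f)) = (x, f)" if "x \<in> supported D" for x f
  proof -
    have "snd (S (T (x, f))) = f"
      by (rule slice_eqI)
        (auto simp: slice_S slice_T linear_add[OF linE] E0 EE EJ[OF that] split: nat.split)
    moreover have "fst (S (T (x, f))) = x"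
      by (simp add: S_def slice_T linear_add[OF lin(2)] E0 QJ[OF that])
    ultimately show ?thesis
      by (metis prod.collapse)
  qed
  have TS: "T (S g) = g" for g
  proof -
    have J_fst: "J (fst (S g)) = E (slice g 0)"
      by (simp add: S_def E_def)
    show ?thesis
    proof (rule slice_eqI)
      fix i
      have "slice (T (S g)) i = (case i of 0 \<Rightarrow> J (fst (S g)) | Suc k \<Rightarrow> E (slice (snd (S g)) k))
          + (slice (snd (S g)) i - E (slice (snd (S g)) i))"
        using slice_T[of "fst (S g)" "snd (S g)" i] by simp
      then show "slice (T (S g)) i = slice g i"
        by (simp add: slice_S linear_add[OF linE] E0 EE J_fst split: nat.splits)
    qed
  qed
  have bound_E: "?G (E f) \<le> ennreal (c * c) * ?G f" for f
  proof -
    have "?G (E f) \<le> ennreal c * ?X (Q f)"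
      unfolding E_def by (rule J(2))
    also have "\<dots> \<le> ennreal c * (ennreal c * ?G f)"
      by (intro mult_left_mono Q(2)) auto
    finally show ?thesis
      using c by (simp add: ennreal_mult mult.assoc)
  qed
  have bound_diff: "?G (f - E f) \<le> ennreal a * ?G f" for f
  proof -
    have "?G (f - E f) = ?G (\<lambda>b. f b + (-1) * E f b)"
      by (simp add: fun_diff_def)
    also have "\<dots> \<le> ennreal (2 powr p) * (?G f + ?G (\<lambda>b. (-1) * E f b))"
      using p by (intro block_sum_add) auto
    also have "?G (\<lambda>b. (-1) * E f b) = ?G (E f)"
      by (subst block_sum_scale) simp
    also have "ennreal (2 powr p) * (?G f + ?G (E f)) \<le> ennreal (2 powr p) * (?G f + ennreal (c * c) * ?G f)"
      by (intro mult_left_mono add_left_mono bound_E) auto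
    also have "\<dots> = ennreal (2 powr p) * (1 + ennreal (c * c)) * ?G f"
      by (simp add: distrib_right distrib_left mult.assoc)
    also have "ennreal (2 powr p) * (1 + ennreal (c * c)) = ennreal a"
      using c by (simp add: a_def ennreal_mult)
    finally show ?thesis .
  qed
  have bound_sum: "(\<Sum>\<^sub>\<infinity>i\<in>UNIV. ?G (u i + (slice f i - E (slice f i))))
      \<le> ennreal (2 powr p) * ((\<Sum>\<^sub>\<infinity>i\<in>UNIV. ?G (u i)) + ennreal a * ?H f)" for u and f :: "'b \<times> nat \<Rightarrow> real"
  proof -
    have "(\<Sum>\<^sub>\<infinity>i\<in>UNIV. ?G (u i + (slice f i - E (slice f i))))
      \<le> (\<Sum>\<^sub>\<infinity>i\<in>UNIV. ennreal (2 powr p) * (?G (u i) + ennreal a * ?G (slice f i)))"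
    proof (intro infsum_ennreal_mono)
      fix i
      have "?G (u i + (slice f i - E (slice f i))) \<le> ennreal (2 powr p) * (?G (u i) + ?G (slice f i - E (slice f i)))"
        unfolding plus_fun_def using p by (intro block_sum_add) auto
      also have "\<dots> \<le> ennreal (2 powr p) * (?G (u i) + ennreal a * ?G (slice f i))"
        by (intro mult_left_mono add_left_mono bound_diff) auto
      finally show "?G (u i + (slice f i - E (slice f i))) \<le> ennreal (2 powr p) * (?G (u i) + ennreal a * ?G (slice f i))" .
    qed
    then show ?thesis
      by (simp only: infsum_ennreal_cmult infsum_ennreal_add block_sum_singletons_Times)
  qed
  have bound_shift: "(\<Sum>\<^sub>\<infinity>i\<in>UNIV. ?G (E (slice f (Suc i)))) \<le> ennreal (c * c) * ?H f" 
    "(\<Sum>\<^sub>\<infinity>i\<in>UNIV. ?G (E (slice f i))) \<le> ennreal (c * c) * ?H f" for f :: "'b \<times> nat \<Rightarrow> real"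
  proof -
    show *: "(\<Sum>\<^sub>\<infinity>i\<in>UNIV. ?G (E (slice f i))) \<le> ennreal (c * c) * ?H f"
      unfolding block_sum_singletons_Times infsum_ennreal_cmult[symmetric]
      by (intro infsum_ennreal_mono bound_E)
    show "(\<Sum>\<^sub>\<infinity>i\<in>UNIV. ?G (E (slice f (Suc i)))) \<le> ennreal (c * c) * ?H f"
      by (rule order_trans[OF _ *]) (subst (2) infsum_nat_eq_0_plus_Suc, simp)
  qed
  have HT: "?H (T (x, f)) \<le> ennreal C * (?X x + ?H f)" for x f
  proof -
    have "?H (T (x, f)) \<le> ennreal (2 powr p) * ((\<Sum>\<^sub>\<infinity>i\<in>UNIV. ?G (case i of 0 \<Rightarrow> J x | Suc k \<Rightarrow> E (slice f k))) + ennreal a * ?H f)"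
      unfolding block_sum_singletons_Times[of p B "T (x, f)"] slice_T by (rule bound_sum)
    also have "(\<Sum>\<^sub>\<infinity>i\<in>UNIV. ?G (case i of 0 \<Rightarrow> J x | Suc k \<Rightarrow> E (slice f k)))
        = ?G (J x) + (\<Sum>\<^sub>\<infinity>i\<in>UNIV. ?G (E (slice f i)))"
      by (subst infsum_nat_eq_0_plus_Suc) simp
    also have "ennreal (2 powr p) * (?G (J x) + (\<Sum>\<^sub>\<infinity>i\<in>UNIV. ?G (E (slice f i))) + ennreal a * ?H f)
       \<le> ennreal (2 powr p) * (ennreal c * ?X x + ennreal (c * c) * ?H f + ennreal a * ?H f)"
      by (intro mult_left_mono add_mono J(2) bound_shift) auto
    also have "ennreal c * ?X x + ennreal (c * c) * ?H f + ennreal a * ?H f = ennreal c * ?X x + ennreal (c * c + a) * ?H f"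
      using pos(1) c by (simp add: distrib_right add.assoc)
    also have "ennreal (2 powr p) * \<dots>
        \<le> ennreal (2 powr p) * (ennreal (c + c * c + a) * ?X x + ennreal (c + c * c + a) * ?H f)"
      using pos(1) c by (intro mult_left_mono add_mono mult_right_mono ennreal_leI) auto
    also have "\<dots> = ennreal (2 powr p) * (ennreal (c + c * c + a) * (?X x + ?H f))"
      by (simp only: distrib_left)
    also have "\<dots> = ennreal (2 powr p * (c + c * c + a)) * (?X x + ?H f)"
      using pos c by (simp add: ennreal_mult mult.assoc)
    also have "\<dots> \<le> ennreal C * (?X x + ?H f)"
      by (intro mult_right_mono ennreal_leI pos) auto
    finally show ?thesis .
  qed
  have HS: "?X (fst (S g)) \<le> ennreal C * ?H g" "?H (snd (S g)) \<le> ennreal C * ?H g" for g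
  proof -
    have "?X (fst (S g)) \<le> ennreal c * ?G (slice g 0)"
      by (simp add: S_def Q(2))
    also have "\<dots> \<le> ennreal C * ?H g"
      unfolding block_sum_singletons_Times
      by (intro mult_mono ennreal_leI pos member_le_infsum_ennreal[of 0 UNIV "\<lambda>i. ?G (slice g i)"]) auto
    finally show "?X (fst (S g)) \<le> ennreal C * ?H g" .
    have "?H (snd (S g)) \<le> ennreal (2 powr p) * ((\<Sum>\<^sub>\<infinity>i\<in>UNIV. ?G (E (slice g (Suc i)))) + ennreal a * ?H g)"
      unfolding block_sum_singletons_Times[of p B "snd (S g)"] slice_S by (rule bound_sum)
    also have "\<dots> \<le> ennreal (2 powr p) * (ennreal (c * c) * ?H g + ennreal a * ?H g)"
      by (intro mult_left_mono add_right_mono bound_shift) auto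
    also have "\<dots> = ennreal (2 powr p * (c * c + a)) * ?H g"
      using pos c by (simp add: ennreal_mult distrib_right distrib_left mult.assoc)
    also have "\<dots> \<le> ennreal C * ?H g"
    proof (intro mult_right_mono ennreal_leI)
      have "2 powr p * (c * c + a) \<le> 2 powr p * (c + c * c + a)"
        using c by (intro mult_left_mono) auto
      then show "2 powr p * (c * c + a) \<le> C"
        using pos(4) by linarith
    qed auto
    finally show "?H (snd (S g)) \<le> ennreal C * ?H g" .
  qed
  let ?NX = "block_enorm p P" and ?NH = "block_enorm p (singletons (B \<times> (UNIV :: nat set)))"
  define K where "K = 2 * 2 powr (1 / p) * C powr (1 / p)"
  have K: "2 powr (1 / p) * C powr (1 / p) \<le> K" "2 * C powr (1 / p) \<le> K" "0 < K"
  proof -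
    have "1 \<le> 2 powr (1 / p)"
      using p by (intro ge_one_powr_ge_zero) auto
    moreover have "0 < C powr (1 / p)"
      using pos(2) by simp
    ultimately show "2 powr (1 / p) * C powr (1 / p) \<le> K" "2 * C powr (1 / p) \<le> K" "0 < K"
      by (simp_all add: K_def)
  qed
  have NT: "?NH (T (x, f)) \<le> ennreal K * (?NX x + ?NH f)" for x f
  proof -
    have "?NH (T (x, f)) \<le> ennreal (C powr (1 / p)) * epowr (?X x + ?H f) (1 / p)"
      unfolding block_enorm_def using pos(2) p by (intro epowr_scaled_le HT) auto
    also have "\<dots> \<le> ennreal (C powr (1 / p)) * (ennreal (2 powr (1 / p)) * (?NX x + ?NH f))"
      unfolding block_enorm_def using p by (intro mult_left_mono epowr_add_le) auto
    also have "\<dots> = ennreal (2 powr (1 / p) * C powr (1 / p)) * (?NX x + ?NH f)"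
      by (simp add: ennreal_mult mult_ac)
    also have "\<dots> \<le> ennreal K * (?NX x + ?NH f)"
      by (intro mult_right_mono ennreal_leI K) auto
    finally show ?thesis .
  qed
  have NS: "?NX (fst (S g)) + ?NH (snd (S g)) \<le> ennreal K * ?NH g" for g
  proof -
    have "?NX (fst (S g)) + ?NH (snd (S g)) \<le> ennreal (C powr (1 / p)) * ?NH g + ennreal (C powr (1 / p)) * ?NH g"
      by (intro add_mono block_enorm_le HS less_imp_le[OF pos(2)] p refl)
    also have "\<dots> = ennreal (2 * C powr (1 / p)) * ?NH g"
      unfolding mult_2[symmetric] by (simp add: ennreal_mult mult.assoc)
    also have "\<dots> \<le> ennreal K * ?NH g"
      by (intro mult_right_mono ennreal_leI K) auto
    finally show ?thesis .
  qed
  have J0: "J x b = 0" if "b \<notin> B" for x b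
    using J(1)[of x] that by blast
  have Q0: "Q f j = 0" if "j \<notin> D" for f j
    using Q(1)[of f] that by blast
  have supp_T: "T (x, f) \<in> supported (B \<times> UNIV)" if "f \<in> supported (B \<times> UNIV)" for x f
    using that J0 by (auto simp: T_def E_def slice_def split: nat.split)
  have supp_S: "S g \<in> supported D \<times> supported (B \<times> UNIV)" if "g \<in> supported (B \<times> UNIV)" for g
    using that J0 Q0 by (auto simp: S_def E_def slice_def)
  have "linear_iso (finite_part (supported D \<times> supported (B \<times> UNIV)) (\<lambda>(x, f). ?NX x + ?NH f))
     (finite_part (supported (B \<times> UNIV)) ?NH)"
  proof (rule linear_iso_finite_partI[OF linT linS K(3)])
    fix z :: "('a \<Rightarrow> real) \<times> ('b \<times> nat \<Rightarrow> real)" assume z: "z \<in> supported D \<times> supported (B \<times> UNIV)"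
    obtain x f where [simp]: "z = (x, f)"
      by (cases z)
    have xf: "x \<in> supported D" "f \<in> supported (B \<times> UNIV)"
      using z by auto
    show "T z \<in> supported (B \<times> UNIV) \<and> S (T z) = z \<and> ?NH (T z) \<le> ennreal K * (case z of (x, f) \<Rightarrow> ?NX x + ?NH f)"
      using supp_T[OF xf(2), of x] ST[OF xf(1), of f] NT[of x f] by simp
  next
    fix g :: "'b \<times> nat \<Rightarrow> real" assume g: "g \<in> supported (B \<times> UNIV)"
    show "S g \<in> supported D \<times> supported (B \<times> UNIV) \<and> T (S g) = g \<and>
        (case S g of (x, f) \<Rightarrow> ?NX x + ?NH f) \<le> ennreal K * ?NH g"
      using supp_S[OF g] TS[of g] NS[of g] by (simp add: case_prod_unfold)
  qed
  from linear_iso_trans[OF linear_iso_sym[OF direct_sum_finite_part] this] show ?thesis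
    by (simp only: seq_space_eq_finite_part lp_space_eq)
qed

section \<open>Infinitely many finite blocks\<close>

text \<open>The functions \<open>\<Sum>\<^sub>j x\<^sub>j r\<^sub>j\<close> on the cubes of all blocks, normalised so that a function of
  constant modulus \<open>1\<close> on a cube has \<open>\<ell>\<^sub>p\<close> norm \<open>1\<close>. The index \<open>(M, S)\<close> is the point \<open>S\<close> of the cube over the block \<open>M\<close>.\<close>

definition rademacher_embed :: "real \<Rightarrow> 'a set set \<Rightarrow> ('a \<Rightarrow> real) \<Rightarrow> 'a set \<times> 'a set \<Rightarrow> real"
  where "rademacher_embed p P x = (\<lambda>(M, S). if M \<in> P \<and> S \<subseteq> M
    then (2 ^ card M) powr (- 1 / p) * (\<Sum>j\<in>M. rademacher j S * x j) else 0)"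

text \<open>Rademacher coefficients of \<open>f\<close> on the cube over the block of \<open>j\<close>, cut off outside \<open>D\<close>. The exponent
  \<open>1/p - 1\<close> combines the factor \<open>2\<^bsup>-|M|\<^esup>\<close> of the coefficients with the inverse of the normalisation
  of \<open>rademacher_embed\<close>.\<close>

definition rademacher_project :: "real \<Rightarrow> 'a set set \<Rightarrow> 'a set \<Rightarrow> ('a set \<times> 'a set \<Rightarrow> real) \<Rightarrow> 'a \<Rightarrow> real"
  where "rademacher_project p P D f = (\<lambda>j. if j \<in> D
    then (2 ^ card (block_of P j)) powr (1 / p - 1) *
      (\<Sum>S\<in>Pow (block_of P j). rademacher j S * f (block_of P j, S)) else 0)"

lemma linear_rademacher_embed: "linear (rademacher_embed p P)"
  by (rule linearI)
    (auto simp: rademacher_embed_def fun_eq_iff scaleR_fun_def algebra_simps sum.distrib sum_distrib_left)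

lemma linear_rademacher_project: "linear (rademacher_project p P D)"
  by (rule linearI)
    (auto simp: rademacher_project_def fun_eq_iff scaleR_fun_def algebra_simps sum.distrib sum_distrib_left)

lemma rademacher_project_embed:
  assumes P: "partition_on A P" and fin: "\<forall>M\<in>P. finite M" and D: "D \<subseteq> A" and x: "x \<in> supported D"
  shows "rademacher_project p P D (rademacher_embed p P x) = x"
proof
  fix j
  show "rademacher_project p P D (rademacher_embed p P x) j = x j"
  proof (cases "j \<in> D")
    case True
    define M where "M = block_of P j"
    have M: "M \<in> P" "j \<in> M" "finite M"
      using block_of_mem[OF P] True D fin by (auto simp: M_def)
    let ?n = "(2 :: real) ^ card M"
    have "rademacher_project p P D (rademacher_embed p P x) j
        = ?n powr (1 / p - 1) * (\<Sum>S\<in>Pow M. rademacher j S * (?n powr (- 1 / p) * (\<Sum>i\<in>M. rademacher i S * x i)))"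
      using True M by (simp add: rademacher_project_def rademacher_embed_def flip: M_def)
    also have "\<dots> = ?n powr (1 / p - 1) * (?n powr (- 1 / p) * (?n * x j))"
      using rademacher_coefficient[OF M(3,2), of x]
      by (simp add: sum_distrib_left[symmetric] mult.left_commute[of "rademacher _ _" "_ powr _"])
    also have "\<dots> = x j"
      by (simp add: powr_diff powr_minus field_simps)
    finally show ?thesis .
  qed (use x in \<open>auto simp: rademacher_project_def\<close>)
qed

lemma epowr_finite_sum_squares:
  assumes "finite M"
  shows "epowr (\<Sum>\<^sub>\<infinity>j\<in>M. ennreal ((x j)\<^sup>2)) r = ennreal ((\<Sum>j\<in>M. (x j)\<^sup>2) powr r)"
  using assms by (simp add: sum_nonneg)

lemma block_sum_singletons_Sigma:
  assumes "\<forall>M\<in>P. finite M"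
  shows "block_sum p (singletons (Sigma P Pow)) f = (\<Sum>\<^sub>\<infinity>M\<in>P. ennreal (\<Sum>S\<in>Pow M. \<bar>f (M, S)\<bar> powr p))"
proof -
  have "block_sum p (singletons (Sigma P Pow)) f = (\<Sum>\<^sub>\<infinity>M\<in>P. \<Sum>\<^sub>\<infinity>S\<in>Pow M. ennreal (\<bar>f (M, S)\<bar> powr p))"
    unfolding block_sum_singletons infsum_ennreal_Sigma by (simp add: case_prod_unfold)
  also have "\<dots> = (\<Sum>\<^sub>\<infinity>M\<in>P. ennreal (\<Sum>S\<in>Pow M. \<bar>f (M, S)\<bar> powr p))"
    using assms by (intro infsum_cong) simp
  finally show ?thesis .
qed

lemma rademacher_embed_bound:
  assumes fin: "\<forall>M\<in>P. finite M" and p: "0 < p"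
  shows "block_sum p (singletons (Sigma P Pow)) (rademacher_embed p P x) \<le> ennreal (khintchine p) * block_sum p P x"
  unfolding block_sum_singletons_Sigma[OF fin] block_sum_def[of p P] infsum_ennreal_cmult[symmetric]
proof (rule infsum_ennreal_mono)
  fix M assume M: "M \<in> P"
  then have [simp]: "finite M"
    using fin by blast
  let ?n = "(2 :: real) ^ card M"
  have "(?n powr (- 1 / p)) powr p = ?n powr (- 1)"
    using p by (simp only: powr_powr) simp
  then have scale: "(?n powr (- 1 / p)) powr p = inverse ?n"
    by (simp only: powr_minus) simp
  have "(\<Sum>S\<in>Pow M. \<bar>rademacher_embed p P x (M, S)\<bar> powr p)
      = (\<Sum>S\<in>Pow M. inverse ?n * \<bar>\<Sum>j\<in>M. rademacher j S * x j\<bar> powr p)"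
  proof (intro sum.cong refl)
    fix S assume "S \<in> Pow M"
    then have "rademacher_embed p P x (M, S) = ?n powr (- 1 / p) * (\<Sum>j\<in>M. rademacher j S * x j)"
      using M by (auto simp: rademacher_embed_def)
    then have "\<bar>rademacher_embed p P x (M, S)\<bar> = ?n powr (- 1 / p) * \<bar>\<Sum>j\<in>M. rademacher j S * x j\<bar>"
      by (simp only: abs_mult) simp
    then show "\<bar>rademacher_embed p P x (M, S)\<bar> powr p = inverse ?n * \<bar>\<Sum>j\<in>M. rademacher j S * x j\<bar> powr p"
      by (simp only: powr_mult scale)
  qed
  also have "\<dots> = inverse ?n * (\<Sum>S\<in>Pow M. \<bar>\<Sum>j\<in>M. rademacher j S * x j\<bar> powr p)"
    by (simp only: sum_distrib_left)
  also have "\<dots> \<le> inverse ?n * (?n * (khintchine p * (\<Sum>j\<in>M. (x j)\<^sup>2) powr (p / 2)))"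
    using p by (intro mult_left_mono khintchine_upper) auto
  also have "\<dots> = khintchine p * (\<Sum>j\<in>M. (x j)\<^sup>2) powr (p / 2)"
    by simp
  finally have "(\<Sum>S\<in>Pow M. \<bar>rademacher_embed p P x (M, S)\<bar> powr p)
      \<le> khintchine p * (\<Sum>j\<in>M. (x j)\<^sup>2) powr (p / 2)" .
  then show "ennreal (\<Sum>S\<in>Pow M. \<bar>rademacher_embed p P x (M, S)\<bar> powr p)
      \<le> ennreal (khintchine p) * epowr (\<Sum>\<^sub>\<infinity>j\<in>M. ennreal ((x j)\<^sup>2)) (p / 2)"
    unfolding epowr_finite_sum_squares[OF \<open>finite M\<close>]
    by (subst ennreal_mult[symmetric]) (auto simp: khintchine_def intro!: ennreal_leI)
qed

lemma rademacher_project_bound: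
  assumes P: "partition_on A P" and fin: "\<forall>M\<in>P. finite M" and p: "2 \<le> p"
  shows "block_sum p P (rademacher_project p P D f) \<le> block_sum p (singletons (Sigma P Pow)) f"
  unfolding block_sum_singletons_Sigma[OF fin] block_sum_def[of p P]
proof (rule infsum_ennreal_mono)
  fix M assume M: "M \<in> P"
  then have [simp]: "finite M"
    using fin by blast
  let ?n = "(2 :: real) ^ card M" and ?c = "\<lambda>j. \<Sum>S\<in>Pow M. rademacher j S * f (M, S)"
  have "(\<Sum>j\<in>M. (rademacher_project p P D f j)\<^sup>2) \<le> (\<Sum>j\<in>M. (?n powr (1 / p - 1) * ?c j)\<^sup>2)"
    by (intro sum_mono) (auto simp: rademacher_project_def block_of_eq[OF P M])
  also have "\<dots> = (?n powr (1 / p - 1))\<^sup>2 * (\<Sum>j\<in>M. (?c j)\<^sup>2)"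
    by (simp only: power_mult_distrib sum_distrib_left[symmetric])
  finally have "(\<Sum>j\<in>M. (rademacher_project p P D f j)\<^sup>2) powr (p / 2)
      \<le> ((?n powr (1 / p - 1))\<^sup>2 * (\<Sum>j\<in>M. (?c j)\<^sup>2)) powr (p / 2)"
    using p by (intro powr_mono2) (auto intro: sum_nonneg)
  also have "\<dots> = ?n powr (1 - p) * (\<Sum>j\<in>M. (?c j)\<^sup>2) powr (p / 2)"
  proof -
    have "(?n powr (1 / p - 1))\<^sup>2 = ?n powr ((1 / p - 1) + (1 / p - 1))"
      unfolding powr_add by (rule power2_eq_square)
    then have "((?n powr (1 / p - 1))\<^sup>2) powr (p / 2) = ?n powr (1 - p)"
      using p by (simp add: powr_powr algebra_simps)
    then show ?thesis
      by (simp add: powr_mult sum_nonneg)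
  qed
  also have "\<dots> \<le> ?n powr (1 - p) * (?n powr (p - 1) * (\<Sum>S\<in>Pow M. \<bar>f (M, S)\<bar> powr p))"
    using p by (intro mult_left_mono rademacher_projection_bound) auto
  also have "\<dots> = (\<Sum>S\<in>Pow M. \<bar>f (M, S)\<bar> powr p)"
    by (simp add: mult.assoc[symmetric] flip: powr_add)
  finally show "epowr (\<Sum>\<^sub>\<infinity>j\<in>M. ennreal ((rademacher_project p P D f j)\<^sup>2)) (p / 2)
      \<le> ennreal (\<Sum>S\<in>Pow M. \<bar>f (M, S)\<bar> powr p)"
    unfolding epowr_finite_sum_squares[OF \<open>finite M\<close>] by (rule ennreal_leI)
qed

text \<open>Let \<open>E\<close> contain one point of each block and let \<open>D\<close> be the rest. On \<open>E\<close> the block norm is the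
  \<open>\<ell>\<^sub>p\<close> norm, and \<open>E\<close> is countably infinite. So the coordinates in \<open>E\<close> form a copy of \<open>\<ell>\<^sub>p\<close>, which absorbs
  the space of the coordinates in \<open>D\<close>, complemented in \<open>\<ell>\<^sub>p\<close> by the Rademacher maps.\<close>

lemma linear_iso_finite_blocks_ell:
  assumes p: "2 < p" and A: "countable A" and P: "partition_on A P"
    and inf: "infinite P" and fin: "\<forall>M\<in>P. finite M"
  shows "linear_iso (seq_space A (block_enorm p P)) (ell p)"
proof -
  define a where "a = (\<lambda>M. SOME j. j \<in> (M :: 'a set))"
  have a: "a M \<in> M" if "M \<in> P" for M
    using P that unfolding a_def some_in_eq by (auto simp: partition_on_def)
  have inj: "inj_on a P"
  proof (rule inj_onI)
    fix M N assume MN: "M \<in> P" "N \<in> P" "a M = a N"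
    then show "M = N"
      using a[of M] a[of N] block_of_eq[OF P] by metis
  qed
  define E where "E = a ` P"
  define D where "D = A - E"
  have E: "E \<subseteq> A" "infinite E" "countable E"
  proof -
    show "E \<subseteq> A"
      using a P by (auto simp: E_def partition_on_def)
    then show "countable E"
      using A countable_subset by blast
    show "infinite E"
      using inf inj finite_image_iff by (auto simp: E_def)
  qed
  define B where "B = Sigma P Pow"
  have B: "countable B" "B \<noteq> {}"
  proof -
    show "countable B"
      unfolding B_def using fin countable_partition[OF A P] by (intro countable_SIGMA) (simp_all add: countable_finite)
    show "B \<noteq> {}"
    proof -
      obtain M where "M \<in> P"
        using inf by fastforce
      then have "(M, {}) \<in> B"
        by (simp add: B_def)
      then show ?thesis
        by blast
    qed
  qed
  then have BN: "countable (B \<times> (UNIV :: nat set))" "infinite (B \<times> (UNIV :: nat set))"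
    by (simp_all add: finite_cartesian_product_iff)
  have E_blocks: "(\<inter>) E ` P - {{}} = singletons E"
  proof -
    have "E \<inter> M = {a M}" if "M \<in> P" for M
    proof -
      have "j = a M" if "j \<in> E" "j \<in> M" for j
      proof -
        obtain N where N: "N \<in> P" "j = a N"
          using \<open>j \<in> E\<close> by (auto simp: E_def)
        then have "N = M"
          using block_of_eq[OF P \<open>N \<in> P\<close>, of j] block_of_eq[OF P \<open>M \<in> P\<close> \<open>j \<in> M\<close>] a by simp
        then show ?thesis
          using N by simp
      qed
      then show ?thesis
        using a[OF that] that by (auto simp: E_def)
    qed
    then show ?thesis
      by (auto simp: E_def image_image cong: image_cong)
  qed
  have absorb: "linear_iso (seq_space D (block_enorm p P) \<oplus>\<^sub>B lp_space p (B \<times> (UNIV :: nat set)))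
      (lp_space p (B \<times> (UNIV :: nat set)))"
  proof (rule linear_iso_absorb)
    show "linear (rademacher_embed p P)" "linear (rademacher_project p P D)"
      by (rule linear_rademacher_embed linear_rademacher_project)+
    show "block_sum p (singletons B) (rademacher_embed p P x) \<le> ennreal (khintchine p + 1) * block_sum p P x" for x
      unfolding B_def using p
      by (intro order_trans[OF rademacher_embed_bound[OF fin]] mult_right_mono ennreal_leI) auto
    show "block_sum p P (rademacher_project p P D f) \<le> ennreal (khintchine p + 1) * block_sum p (singletons B) f" for f
    proof -
      have "block_sum p P (rademacher_project p P D f) \<le> ennreal 1 * block_sum p (singletons B) f"
        using rademacher_project_bound[OF P fin, of p D f] p by (simp add: B_def)
      also have "\<dots> \<le> ennreal (khintchine p + 1) * block_sum p (singletons B) f"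
        by (intro mult_right_mono ennreal_leI) (auto simp: khintchine_def)
      finally show ?thesis .
    qed
    show "rademacher_project p P D (rademacher_embed p P x) = x" if "x \<in> supported D" for x
      using rademacher_project_embed[OF P fin _ that] by (simp add: D_def)
  qed (use p in \<open>auto simp: khintchine_def rademacher_embed_def rademacher_project_def B_def\<close>)
  have "linear_iso (seq_space A (block_enorm p P)) (seq_space D (block_enorm p P) \<oplus>\<^sub>B seq_space E (block_enorm p P))"
  proof -
    have "D \<inter> E = {}" "D \<union> E = A"
      using E(1) by (auto simp: D_def)
    then show ?thesis
      using linear_iso_split[of p D E P] p by simp
  qed
  also have "linear_iso \<dots> (seq_space D (block_enorm p P) \<oplus>\<^sub>B lp_space p (B \<times> (UNIV :: nat set)))"
  proof (rule linear_iso_direct_sum_seq[OF linear_iso_refl])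
    have "linear_iso (seq_space E (block_enorm p P)) (lp_space p E)"
      unfolding lp_space_eq
    proof (rule linear_iso_seq_space_cong)
      fix x :: "'a \<Rightarrow> real" assume "x \<in> supported E"
      from block_sum_restrict[OF P this, of p]
      show "block_enorm p P x = block_enorm p (singletons E) x"
        unfolding block_enorm_def E_blocks by simp
    qed
    also have "linear_iso (lp_space p E) (lp_space p (B \<times> (UNIV :: nat set)))"
      using E BN p by (intro linear_iso_lp_space_countable) auto
    finally show "linear_iso (seq_space E (block_enorm p P)) (lp_space p (B \<times> (UNIV :: nat set)))" .
  qed
  also note absorb
  also have "linear_iso (lp_space p (B \<times> (UNIV :: nat set))) (ell p)"
    using BN p by (intro linear_iso_lp_space_countable) auto
  finally show ?thesis .
qed

section \<open>Sums of Euclidean spaces\<close>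

text \<open>Nonemptiness keeps the sets \<open>{i} \<times> B i\<close> distinct for distinct \<open>i\<close>.\<close>

lemma block_sum_Sigma:
  assumes "\<forall>i\<in>I. B i \<noteq> {}"
  shows "block_sum p ((\<lambda>i. {i} \<times> B i) ` I) x
    = (\<Sum>\<^sub>\<infinity>i\<in>I. epowr (\<Sum>\<^sub>\<infinity>k\<in>B i. ennreal ((x (i, k))\<^sup>2)) (p / 2))"
proof -
  have "inj_on (\<lambda>i. {i} \<times> B i) I"
    using assms by (fastforce simp: inj_on_def)
  moreover have "(\<Sum>\<^sub>\<infinity>j\<in>{i} \<times> B i. ennreal ((x j)\<^sup>2)) = (\<Sum>\<^sub>\<infinity>k\<in>B i. ennreal ((x (i, k))\<^sup>2))" for i
  proof -
    have "{i} \<times> B i = Pair i ` B i"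
      by auto
    then show ?thesis
      by (simp only:) (subst infsum_reindex, auto simp: inj_on_def o_def)
  qed
  ultimately show ?thesis
    unfolding block_sum_def by (subst infsum_reindex) (simp_all add: o_def)
qed

text \<open>Currying is an isometry: the finiteness conditions of an \<open>\<ell>\<^sub>p\<close>-sum on the single components follow
  from finiteness of the whole block sum, each of whose terms is dominated by it.\<close>

lemma linear_iso_Sigma_lp_sum:
  assumes p: "0 < p" and ne: "\<forall>i\<in>I. B i \<noteq> {}"
  shows "linear_iso (seq_space (Sigma I B) (block_enorm p ((\<lambda>i. {i} \<times> B i) ` I)))
           (lp_sum p I (\<lambda>i. lp_space 2 (B i)))"
proof -
  let ?X = "seq_space (Sigma I B) (block_enorm p ((\<lambda>i. {i} \<times> B i) ` I))"
    and ?Y = "lp_sum p I (\<lambda>i. lp_space 2 (B i))"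
  let ?s = "\<lambda>y i. \<Sum>\<^sub>\<infinity>k\<in>B i. ennreal ((y i k)\<^sup>2)"
  have l2: "lp_enorm 2 (B i) u = epowr (\<Sum>\<^sub>\<infinity>k\<in>B i. ennreal ((u k)\<^sup>2)) (1 / 2)" for i u
    by (simp add: lp_enorm_def)
  have norm_eq: "lp_sum_enorm p I (\<lambda>i. lp_space 2 (B i)) y = block_enorm p ((\<lambda>i. {i} \<times> B i) ` I) (case_prod y)"
    if "\<And>i. i \<in> I \<Longrightarrow> ?s y i < top" for y
  proof -
    have "ennreal (vnorm (lp_space 2 (B i)) (y i) powr p) = epowr (?s y i) (p / 2)" if "i \<in> I" for i
    proof -
      have "lp_enorm 2 (B i) (y i) < top"
        using \<open>\<And>i. i \<in> I \<Longrightarrow> ?s y i < top\<close>[OF that] by (simp add: l2)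
      then show ?thesis
        by (simp add: lp_space_def seq_space_def ennreal_enn2real_powr) (simp add: l2)
    qed
    then show ?thesis
      unfolding lp_sum_enorm_def block_enorm_def block_sum_Sigma[OF ne]
      by (intro arg_cong2[where f = epowr] infsum_cong) auto
  qed
  have vecs_Y: "y \<in> vecs ?Y \<longleftrightarrow> case_prod y \<in> vecs ?X" for y
  proof
    assume y: "y \<in> vecs ?Y"
    have fin: "?s y i < top" and supp: "\<And>k. k \<notin> B i \<Longrightarrow> y i k = 0" if "i \<in> I" for i
      using y that by (auto simp: lp_sum_def lp_space_def seq_space_def l2)
    moreover have "y i k = 0" if "(i, k) \<notin> Sigma I B" for i k
      using y that supp[of i k] by (cases "i \<in> I") (auto simp: lp_sum_def)
    moreover have "lp_sum_enorm p I (\<lambda>i. lp_space 2 (B i)) y < top"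
      using y by (simp add: lp_sum_def)
    ultimately show "case_prod y \<in> vecs ?X"
      unfolding seq_space_def using norm_eq[of y] by (auto simp: norm_eq)
  next
    assume y: "case_prod y \<in> vecs ?X"
    then have "block_sum p ((\<lambda>i. {i} \<times> B i) ` I) (case_prod y) < top"
      by (simp add: seq_space_def)
    then have fin: "?s y i < top" if "i \<in> I" for i
      using member_le_infsum_ennreal[OF that, of "\<lambda>i. epowr (?s y i) (p / 2)"]
      by (auto simp: block_sum_Sigma[OF ne] dest: le_less_trans)
    have zero: "y i k = 0" if "(i, k) \<notin> Sigma I B" for i k
      using y that by (auto simp: seq_space_def)
    have "y i \<in> vecs (lp_space 2 (B i))" if "i \<in> I" for i
      using fin[OF that] zero that by (simp add: lp_space_def seq_space_def l2)
    moreover have "lp_sum_enorm p I (\<lambda>i. lp_space 2 (B i)) y < top"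
      using norm_eq[OF fin] y by (simp add: seq_space_def)
    moreover have "y i = 0" if "i \<notin> I" for i
      using zero that by (simp add: fun_eq_iff)
    ultimately show "y \<in> vecs ?Y"
      by (simp add: lp_sum_def)
  qed
  have norm_Y: "vnorm ?Y y = vnorm ?X (case_prod y)" if "y \<in> vecs ?Y" for y
  proof -
    have "?s y i < top" if "i \<in> I" for i
      using \<open>y \<in> vecs ?Y\<close> that by (auto simp: lp_sum_def lp_space_def seq_space_def l2)
    then show ?thesis
      by (simp add: lp_sum_def seq_space_def norm_eq)
  qed
  have lin: "linear (curry :: ('i \<times> 'b \<Rightarrow> real) \<Rightarrow> _)" "linear (case_prod :: ('i \<Rightarrow> 'b \<Rightarrow> real) \<Rightarrow> _)"
    by (auto intro!: linearI simp: fun_eq_iff scaleR_fun_def)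
  show ?thesis
    unfolding linear_iso_def
  proof (intro exI[of _ curry] exI[of _ case_prod] exI[of _ "1 :: real"] conjI ballI)
    fix x assume x: "x \<in> vecs ?X"
    then show "curry x \<in> vecs ?Y"
      by (simp add: vecs_Y)
    with x show "vnorm ?Y (curry x) \<le> 1 * vnorm ?X x"
      by (simp add: norm_Y)
  next
    fix y assume y: "y \<in> vecs ?Y"
    then show "case_prod y \<in> vecs ?X" "vnorm ?X (case_prod y) \<le> 1 * vnorm ?Y y"
      by (simp_all add: vecs_Y norm_Y)
  qed (simp_all add: lin)
qed

text \<open>Label each coordinate by its block, which carries the partition to the fibres of a disjoint union.\<close>

lemma linear_iso_lp_sum_blocks:
  assumes p: "0 < p" and P: "partition_on A P"
  shows "linear_iso (seq_space A (block_enorm p P)) (lp_sum p P (\<lambda>M. lp_space 2 M))"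
proof -
  define \<phi> where "\<phi> = (\<lambda>j. (block_of P j, j))"
  have "bij_betw \<phi> A (Sigma P (\<lambda>M. M))"
  proof (rule bij_betwI')
    fix y assume "y \<in> Sigma P (\<lambda>M. M)"
    then show "\<exists>j\<in>A. y = \<phi> j"
      using P by (intro bexI[of _ "snd y"]) (auto simp: \<phi>_def block_of_eq[OF P] partition_on_def)
  qed (auto simp: \<phi>_def block_of_mem[OF P])
  from linear_iso_reindex[OF this P p]
  have "linear_iso (seq_space A (block_enorm p P))
      (seq_space (Sigma P (\<lambda>M. M)) (block_enorm p ((`) \<phi> ` P)))" .
  also have "(`) \<phi> ` P = (\<lambda>M. {M} \<times> M) ` P"
  proof (intro image_cong refl)
    fix M assume "M \<in> P"
    then have "\<phi> j = (M, j)" if "j \<in> M" for j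
      using that by (simp add: \<phi>_def block_of_eq[OF P])
    then show "\<phi> ` M = {M} \<times> M"
      by force
  qed
  also have "linear_iso (seq_space (Sigma P (\<lambda>M. M)) (block_enorm p ((\<lambda>M. {M} \<times> M) ` P)))
      (lp_sum p P (\<lambda>M. lp_space 2 M))"
    by (rule linear_iso_Sigma_lp_sum[OF p]) (use P in \<open>auto simp: partition_on_def\<close>)
  finally show ?thesis .
qed

text \<open>Enumerate the blocks and, within each block, its points; this carries the partition to the rows
  of \<open>\<nat> \<times> \<nat>\<close>.\<close>

lemma linear_iso_infinite_blocks:
  assumes p: "0 < p" and A: "countable A" and P: "partition_on A P"
    and inf: "infinite P" "\<forall>M\<in>P. infinite M"
  shows "linear_iso (seq_space A (block_enorm p P)) (lp_sum p (UNIV :: nat set) (\<lambda>_. ell 2))"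
proof -
  have sub: "M \<subseteq> A" "countable M" if "M \<in> P" for M
    using that P A by (auto simp: partition_on_def intro: countable_subset)
  have cP: "countable P"
    using A P by (rule countable_partition)
  define \<phi> where "\<phi> = (\<lambda>j. (to_nat_on P (block_of P j), to_nat_on (block_of P j) j))"
  have e: "bij_betw (to_nat_on P) P UNIV"
    using cP inf by (rule_tac to_nat_on_infinite)
  have g: "bij_betw (to_nat_on M) M UNIV" if "M \<in> P" for M
    using sub(2)[OF that] inf that by (intro to_nat_on_infinite) auto
  have img: "\<phi> ` M = {to_nat_on P M} \<times> UNIV" if "M \<in> P" for M
  proof -
    have "\<phi> j = (to_nat_on P M, to_nat_on M j)" if "j \<in> M" for j
      using that \<open>M \<in> P\<close> by (simp add: \<phi>_def block_of_eq[OF P])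
    then have "\<phi> ` M = {to_nat_on P M} \<times> (to_nat_on M ` M)"
      by force
    then show ?thesis
      using g[OF that] by (simp add: bij_betw_def)
  qed
  have "bij_betw \<phi> A (UNIV \<times> UNIV)"
  proof -
    have "inj_on \<phi> A"
    proof (rule inj_onI)
      fix i j assume ij: "i \<in> A" "j \<in> A" "\<phi> i = \<phi> j"
      then have "block_of P i = block_of P j"
        using e block_of_mem[OF P] by (auto simp: \<phi>_def bij_betw_def dest: inj_onD)
      then show "i = j"
        using ij g[of "block_of P i"] block_of_mem[OF P] by (auto simp: \<phi>_def bij_betw_def dest: inj_onD)
    qed
    moreover have "\<phi> ` A = (\<Union>M\<in>P. \<phi> ` M)"
      using P by (auto simp: partition_on_def)
    moreover have "(\<Union>M\<in>P. \<phi> ` M) = (to_nat_on P ` P) \<times> UNIV"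
      using img by auto
    ultimately show ?thesis
      using e by (simp add: bij_betw_def)
  qed
  from linear_iso_reindex[OF this P p]
  have "linear_iso (seq_space A (block_enorm p P)) (seq_space (UNIV \<times> UNIV) (block_enorm p ((`) \<phi> ` P)))" .
  also have "(`) \<phi> ` P = (\<lambda>i. {i} \<times> UNIV) ` to_nat_on P ` P"
    unfolding image_image by (intro image_cong refl img)
  also have "to_nat_on P ` P = UNIV"
    using e by (simp add: bij_betw_def)
  also have "linear_iso (seq_space (UNIV \<times> UNIV) (block_enorm p ((\<lambda>i. {i} \<times> (UNIV :: nat set)) ` (UNIV :: nat set))))
      (lp_sum p (UNIV :: nat set) (\<lambda>_. ell 2))"
    using linear_iso_Sigma_lp_sum[OF p, of "UNIV :: nat set" "\<lambda>_. UNIV :: nat set"] by simp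
  finally show ?thesis .
qed

section \<open>Infinite blocks\<close>

text \<open>The whole set is a single merger of \<open>|P|\<close> blocks.\<close>

lemma finite_partition_l2_le:
  assumes p: "2 < p" and A: "A \<noteq> {}" and P: "partition_on A P" "finite P" and c: "0 \<le> c"
  shows "ennreal (c * real (card P) powr (1 / p - 1 / 2)) * lp_enorm 2 A x \<le> ennreal c * block_enorm p P x"
proof -
  define n where "n = real (card P)"
  have n: "n > 0"
    using A P by (auto simp: n_def card_gt_0_iff partition_on_def)
  have "block_sum p {A} x \<le> ennreal (n powr (p / 2 - 1)) * block_sum p P x"
    unfolding n_def
  proof (rule block_sum_coarsen[OF p P(1) partition_on_trivial[OF A]])
    show "\<forall>N\<in>P. \<exists>M\<in>{A}. N \<subseteq> M"
      using P(1) by (auto simp: partition_on_def)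
  qed (use P in \<open>auto intro: card_mono\<close>)
  then have "block_enorm p {A} x \<le> ennreal ((n powr (p / 2 - 1)) powr (1 / p)) * block_enorm p P x"
    using p by (intro block_enorm_le) auto
  also have "(n powr (p / 2 - 1)) powr (1 / p) = n powr (1 / 2 - 1 / p)"
    using p by (simp add: powr_powr field_simps)
  finally have le: "lp_enorm 2 A x \<le> ennreal (n powr (1 / 2 - 1 / p)) * block_enorm p P x"
    using p by (simp add: l2_enorm_eq_block_enorm[of p])
  have "ennreal (c * n powr (1 / p - 1 / 2)) * lp_enorm 2 A x
      \<le> ennreal (c * n powr (1 / p - 1 / 2)) * (ennreal (n powr (1 / 2 - 1 / p)) * block_enorm p P x)"
    by (intro mult_left_mono le) auto
  also have "\<dots> = ennreal (c * (n powr (1 / p - 1 / 2) * n powr (1 / 2 - 1 / p))) * block_enorm p P x"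
    using c by (simp add: mult.assoc[symmetric] flip: ennreal_mult)
  also have "n powr (1 / p - 1 / 2) * n powr (1 / 2 - 1 / p) = 1"
    using n by (simp flip: powr_add)
  finally show ?thesis
    by (simp add: n_def)
qed

text \<open>Split the coordinates into the union of the infinite blocks, on which the block norm is equivalent
  to the \<open>\<ell>\<^sub>2\<close> norm, and the union of the finite blocks, of which infinitely many remain.\<close>

lemma linear_iso_finitely_many_infinite_blocks:
  assumes p: "2 < p" and A: "countable A" and P: "partition_on A P" "infinite P"
    and inf: "{M\<in>P. infinite M} \<noteq> {}" "finite {M\<in>P. infinite M}"
  shows "linear_iso (seq_space A (block_enorm p P)) (ell 2 \<oplus>\<^sub>B ell p)"
proof -
  define I F where "I = {M\<in>P. infinite M}" and "F = {M\<in>P. finite M}"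
  have "I \<subseteq> P" "F \<subseteq> P" "I \<union> F = P"
    by (auto simp: I_def F_def)
  moreover from this have "\<Union>I \<union> \<Union>F = A"
    using P(1) by (metis Union_Un_distrib partition_onD1)
  ultimately have IF: "I \<subseteq> P" "F \<subseteq> P" "\<Union>I \<union> \<Union>F = A" "I \<union> F = P"
    by simp_all
  have disj: "\<Union>I \<inter> \<Union>F = {}"
  proof -
    have "M \<inter> N = {}" if "M \<in> I" "N \<in> F" for M N
    proof -
      have "M \<noteq> N"
        using that by (auto simp: I_def F_def)
      then show ?thesis
        using disjointD[OF partition_onD2[OF P(1)], of M N] that IF(1,2) by blast
    qed
    then show ?thesis
      by blast
  qed
  have "infinite F"
    using P(2) inf(2) IF(4) by (metis I_def finite_UnI)
  have sub: "countable (\<Union>I)" "countable (\<Union>F)"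
    using IF(3) A by (metis countable_subset Un_upper1, metis countable_subset Un_upper2)
  have infI: "infinite (\<Union>I)"
    using inf(1) by (auto simp: I_def dest: finite_subset[rotated])
  note part = subfamily_partition(1)[OF P(1) IF(1)] subfamily_partition(1)[OF P(1) IF(2)]
  have "linear_iso (seq_space A (block_enorm p P))
      (seq_space (\<Union>I) (block_enorm p P) \<oplus>\<^sub>B seq_space (\<Union>F) (block_enorm p P))"
    using linear_iso_split[OF _ disj, of p P] p IF(3) by simp
  also have "linear_iso \<dots> (ell 2 \<oplus>\<^sub>B ell p)"
  proof (rule linear_iso_direct_sum_seq)
    have "linear_iso (seq_space (\<Union>I) (block_enorm p P)) (seq_space (\<Union>I) (block_enorm p I))"
      by (rule linear_iso_subfamily[OF P(1) IF(1)])
    also have "linear_iso \<dots> (seq_space (\<Union>I) (block_enorm p {\<Union>I}))"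
    proof (rule linear_iso_enorm_equivalent, rule enorm_equivalentI)
      have ne: "\<Union>I \<noteq> {}"
        using infI by (metis finite.emptyI)
      have "card I > 0"
        using inf by (auto simp: card_gt_0_iff I_def)
      then show "0 < real (card I) powr (1 / p - 1 / 2)"
        by simp
      show "ennreal (real (card I) powr (1 / p - 1 / 2)) * block_enorm p {\<Union>I} x \<le> block_enorm p I x" for x
        using finite_partition_l2_le[OF p ne part(1), of 1 x] inf(2) p
        by (simp add: I_def l2_enorm_eq_block_enorm[of p])
      show "block_enorm p I x \<le> ennreal 1 * block_enorm p {\<Union>I} x" for x
        using block_enorm_mono[OF block_sum_refine[OF p part(1) partition_on_trivial[OF ne]]] p by auto
    qed simp
    also have "linear_iso \<dots> (ell 2)"
      using p sub infI by (intro linear_iso_ell2) auto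
    finally show "linear_iso (seq_space (\<Union>I) (block_enorm p P)) (ell 2)" .
    have "linear_iso (seq_space (\<Union>F) (block_enorm p P)) (seq_space (\<Union>F) (block_enorm p F))"
      by (rule linear_iso_subfamily[OF P(1) IF(2)])
    also have "linear_iso \<dots> (ell p)"
      using \<open>infinite F\<close> by (intro linear_iso_finite_blocks_ell[OF p sub(2) part(2)]) (auto simp: F_def)
    finally show "linear_iso (seq_space (\<Union>F) (block_enorm p P)) (ell p)" .
  qed
  finally show ?thesis .
qed

text \<open>Merge each finite block \<open>N\<close> with an infinite block \<open>h N\<close>, for an injection \<open>h\<close>. Every block of the
  resulting partition \<open>Q\<close> is infinite and consists of at most two blocks of \<open>P\<close>, so the two block norms
  are equivalent.\<close>

lemma linear_iso_infinitely_many_infinite_blocks: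
  assumes p: "2 < p" and A: "countable A" and P: "partition_on A P"
    and inf: "infinite {M\<in>P. infinite M}"
  shows "linear_iso (seq_space A (block_enorm p P)) (lp_sum p (UNIV :: nat set) (\<lambda>_. ell 2))"
proof -
  define I F where "I = {M\<in>P. infinite M}" and "F = {M\<in>P. finite M}"
  have cP: "countable P"
    using A P by (rule countable_partition)
  have "countable I" "countable F"
    using cP by (auto simp: I_def F_def intro: countable_subset)
  define h where "h = from_nat_into I \<circ> to_nat_on F"
  have "inj (from_nat_into I)"
    using bij_betw_from_nat_into[OF \<open>countable I\<close>] inf by (simp add: I_def bij_betw_def)
  then have h_inj: "inj_on h F"
    unfolding h_def using \<open>countable F\<close>
    by (intro comp_inj_on inj_on_to_nat_on) (auto intro: inj_on_subset)
  have h_mem: "h N \<in> I" for N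
    using inf by (auto simp: h_def I_def[symmetric] intro!: from_nat_into)
  note h = h_inj h_mem
  \<comment> \<open>\<open>m\<close> sends a block to the infinite block it is merged into; \<open>q M\<close> is the merger around \<open>M\<close>.\<close>
  define m where "m = (\<lambda>M. if infinite M then M else h M)"
  have m: "m N \<in> I" if "N \<in> P" for N
    using that h by (auto simp: m_def I_def F_def)
  define q where "q = (\<lambda>M. \<Union>{N\<in>P. m N = M})"
  define Q where "Q = q ` I"
  have eqP: "M = N" if "M \<in> P" "N \<in> P" "j \<in> M" "j \<in> N" for M N j
    using P that by (auto simp: partition_on_def disjoint_def)
  have neP: "N \<noteq> {}" if "N \<in> P" for N
    using P that by (auto simp: partition_on_def)
  have self: "M \<subseteq> q M" if "M \<in> I" for M
    using that by (auto simp: q_def m_def I_def)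
  have q_disj: "M = N" if "j \<in> q M" "j \<in> q N" for M N j
    using that eqP unfolding q_def by blast
  have Q: "partition_on A Q"
  proof (rule partition_onI)
    show "\<Union>Q = A"
      using m P by (auto simp: Q_def q_def partition_on_def)
    show "{} \<notin> Q"
      using self neP by (force simp: Q_def I_def)
    show "disjnt K L" if "K \<in> Q" "L \<in> Q" "K \<noteq> L" for K L
      using that q_disj by (auto simp: Q_def disjnt_iff)
  qed
  have "inj_on q I"
  proof (rule inj_onI)
    fix M N assume "M \<in> I" "N \<in> I" "q M = q N"
    moreover obtain j where "j \<in> M"
      using \<open>M \<in> I\<close> neP[of M] by (auto simp: I_def)
    ultimately show "M = N"
      using q_disj[of j M N] self by blast
  qed
  then have "infinite Q"
    using inf by (simp add: Q_def finite_image_iff I_def)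
  moreover have "\<forall>K\<in>Q. infinite K"
    using self by (auto simp: Q_def I_def dest: finite_subset)
  ultimately have iso: "linear_iso (seq_space A (block_enorm p Q)) (lp_sum p (UNIV :: nat set) (\<lambda>_. ell 2))"
    using p by (intro linear_iso_infinite_blocks A Q) auto
  have ref: "\<forall>N\<in>P. \<exists>K\<in>Q. N \<subseteq> K"
    using m by (fastforce simp: Q_def q_def)
  have pieces: "finite {N\<in>P. N \<subseteq> K} \<and> card {N\<in>P. N \<subseteq> K} \<le> 2" if K: "K \<in> Q" for K
  proof -
    obtain M where M: "M \<in> I" "K = q M"
      using K by (auto simp: Q_def)
    have mN: "m N = M" if N: "N \<in> P" "N \<subseteq> K" for N
    proof -
      obtain j where "j \<in> N"
        using neP N by blast
      then show ?thesis
        using N M q_disj[of j "m N" M] by (auto simp: q_def)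
    qed
    have sub: "{N\<in>P. N \<subseteq> K} \<subseteq> {M, inv_into F h M}"
    proof
      fix N assume "N \<in> {N\<in>P. N \<subseteq> K}"
      then have N: "N \<in> P" "m N = M"
        using mN by auto
      show "N \<in> {M, inv_into F h M}"
      proof (cases "infinite N")
        case True
        then show ?thesis
          using N by (simp add: m_def)
      next
        case False
        then have "h N = M" "N \<in> F"
          using N by (auto simp: m_def F_def)
        then show ?thesis
          using inv_into_f_f[OF h_inj] by blast
      qed
    qed
    have "card {M, inv_into F h M} \<le> 2"
      by (simp add: card_insert_if)
    then show ?thesis
      using sub card_mono[OF _ sub] by (auto intro: finite_subset)
  qed
  have "linear_iso (seq_space A (block_enorm p P)) (seq_space A (block_enorm p Q))"
  proof (rule linear_iso_enorm_equivalent, rule enorm_equivalentI)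
    define C where "C = (real 2 powr (p / 2 - 1)) powr (1 / p)"
    show "0 < 1 / C"
      by (simp add: C_def)
    show "ennreal (1 / C) * block_enorm p Q x \<le> block_enorm p P x" for x
    proof -
      have "block_enorm p Q x \<le> ennreal C * block_enorm p P x"
        unfolding C_def using block_sum_coarsen[OF p P Q ref pieces] p by (intro block_enorm_le) auto
      then have "ennreal (1 / C) * block_enorm p Q x \<le> ennreal (1 / C) * (ennreal C * block_enorm p P x)"
        by (rule mult_left_mono) simp
      also have "\<dots> = block_enorm p P x"
        using \<open>0 < 1 / C\<close> by (simp add: mult.assoc[symmetric] flip: ennreal_mult)
      finally show ?thesis .
    qed
    show "block_enorm p P x \<le> ennreal 1 * block_enorm p Q x" for x
      using block_enorm_mono[OF block_sum_refine[OF p P Q ref]] p by auto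
  qed simp
  also note iso
  finally show ?thesis .
qed

section \<open>The norm of \<open>X\<close>\<close>

lemma partition_enorm_le:
  assumes "0 < p" "partition_on A P" "\<forall>k\<in>A. 0 < w k \<and> w k \<le> 1"
  shows "partition_enorm p P w x \<le> block_enorm p P x"
  unfolding partition_enorm_eq_block_enorm
proof (intro block_enorm_mono block_sum_mono)
  fix M j assume "M \<in> P" "j \<in> M"
  then have "0 < w j" "w j \<le> 1"
    using assms(2,3) by (auto simp: partition_on_def)
  then show "\<bar>x j * w j\<bar> \<le> \<bar>x j\<bar>"
    by (simp add: abs_mult mult_left_le)
qed (use assms in auto)

lemma partition_enorm_ge:
  assumes "0 < p" "partition_on A P" "\<forall>k\<in>A. \<delta> \<le> w k" "0 \<le> \<delta>"
  shows "ennreal \<delta> * block_enorm p P x \<le> partition_enorm p P w x"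
proof -
  have "ennreal \<delta> * block_enorm p P x = block_enorm p P (\<lambda>j. \<delta> * x j)"
    using assms by (simp add: block_enorm_scale)
  also have "\<dots> \<le> block_enorm p P (\<lambda>j. x j * w j)"
  proof (intro block_enorm_mono block_sum_mono)
    fix M j assume "M \<in> P" "j \<in> M"
    then have "\<delta> \<le> w j"
      using assms(2,3) by (auto simp: partition_on_def)
    then have "\<delta> * \<bar>x j\<bar> \<le> w j * \<bar>x j\<bar>" "0 \<le> w j"
      using assms(4) by (auto intro: mult_right_mono)
    then show "\<bar>\<delta> * x j\<bar> \<le> \<bar>x j * w j\<bar>"
      using assms(4) by (simp add: abs_mult mult.commute)
  qed (use assms in auto)
  finally show ?thesis
    by (simp add: partition_enorm_eq_block_enorm)
qed

text \<open>Each term of the norm belongs to a partition finer than \<open>Q\<close>, the \<open>\<ell>\<^sub>p\<close> term to the finest one of all.\<close>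

lemma X_enorm_le:
  assumes p: "2 < p" and P: "partition_on A P1" "partition_on A P2" and Q: "partition_on A Q"
    and w: "\<forall>k\<in>A. 0 < w1 k \<and> w1 k \<le> 1" "\<forall>k\<in>A. 0 < w2 k \<and> w2 k \<le> 1"
    and ref: "\<forall>N\<in>P1. \<exists>M\<in>Q. N \<subseteq> M" "\<forall>N\<in>P2. \<exists>M\<in>Q. N \<subseteq> M"
  shows "X_enorm p A P1 w1 P2 w2 x \<le> block_enorm p Q x"
proof -
  have "\<forall>N\<in>singletons A. \<exists>M\<in>Q. N \<subseteq> M"
    using Q by (auto simp: partition_on_def)
  then have "lp_enorm p A x \<le> block_enorm p Q x"
    unfolding lp_enorm_eq_block_enorm using p
    by (intro block_enorm_mono block_sum_refine[OF p partition_on_singletons Q]) auto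
  moreover have "partition_enorm p P1 w1 x \<le> block_enorm p Q x"
    using p by (intro order_trans[OF partition_enorm_le[OF _ P(1) w(1)]]
        block_enorm_mono block_sum_refine[OF p P(1) Q ref(1)]) auto
  moreover have "partition_enorm p P2 w2 x \<le> block_enorm p Q x"
    using p by (intro order_trans[OF partition_enorm_le[OF _ P(2) w(2)]]
        block_enorm_mono block_sum_refine[OF p P(2) Q ref(2)]) auto
  ultimately show ?thesis
    by (simp add: X_enorm_def)
qed

lemma le_X_enorm:
  "lp_enorm p A x \<le> X_enorm p A P1 w1 P2 w2 x"
  "partition_enorm p P1 w1 x \<le> X_enorm p A P1 w1 P2 w2 x"
  "partition_enorm p P2 w2 x \<le> X_enorm p A P1 w1 P2 w2 x"
  by (simp_all add: X_enorm_def le_max_iff_disj)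

text \<open>Equivalent norms are finite on the same families, so the carrier of \<open>X\<close> is a subspace because that
  of the block space is.\<close>

lemma X_space_isomorphic:
  assumes "0 < p" and eq: "enorm_equivalent (X_enorm p A P1 w1 P2 w2) (block_enorm p P)"
    and iso: "linear_iso (seq_space A (block_enorm p P)) Y"
  shows "X_space p A P1 w1 P2 w2 \<sim>\<^sub>B Y"
proof (rule linear_iso_imp_isomorphic)
  let ?N = "X_enorm p A P1 w1 P2 w2"
  show "linear_iso (X_space p A P1 w1 P2 w2) Y"
    unfolding X_space_def using linear_iso_enorm_equivalent[OF eq] iso by (rule linear_iso_trans)
  obtain c C where "c > 0" "C > 0"
    and le: "\<And>x. ennreal c * ?N x \<le> block_enorm p P x" "\<And>x. block_enorm p P x \<le> ennreal C * ?N x"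
    using eq unfolding enorm_equivalent_def by blast
  have "?N x < top \<longleftrightarrow> block_enorm p P x < top" for x
  proof
    assume "?N x < top"
    then have "ennreal C * ?N x < top"
      by (simp add: ennreal_mult_less_top)
    then show "block_enorm p P x < top"
      using le(2)[of x] by (rule le_less_trans[rotated])
  next
    assume "block_enorm p P x < top"
    then have "ennreal c * ?N x < top"
      using le(1)[of x] by (rule le_less_trans[rotated])
    then show "?N x < top"
      using \<open>c > 0\<close> by (auto simp: ennreal_mult_less_top)
  qed
  then have "vecs (X_space p A P1 w1 P2 w2) = vecs (seq_space A (block_enorm p P))"
    by (simp add: X_space_def seq_space_def)
  then show "subspace (vecs (X_space p A P1 w1 P2 w2))"
    using subspace_block_space[of p A P] assms(1) by simp
qed

lemma X_space_finite_partition: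
  assumes p: "2 < p" and A: "countable A" "infinite A" and P: "partition_on A P" "finite P" and c: "0 < c"
    and lower: "\<And>x. ennreal c * block_enorm p P x \<le> X_enorm p A P1 w1 P2 w2 x"
    and upper: "\<And>x. X_enorm p A P1 w1 P2 w2 x \<le> lp_enorm 2 A x"
  shows "X_space p A P1 w1 P2 w2 \<sim>\<^sub>B ell 2"
proof (rule X_space_isomorphic[OF _ _ linear_iso_ell2[OF _ A]])
  have "A \<noteq> {}"
    using A by auto
  have "card P > 0"
    using P \<open>A \<noteq> {}\<close> by (auto simp: card_gt_0_iff partition_on_def)
  then show "enorm_equivalent (X_enorm p A P1 w1 P2 w2) (block_enorm p {A})"
    using p c upper order_trans[OF finite_partition_l2_le[OF p \<open>A \<noteq> {}\<close> P less_imp_le[OF c]] lower]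
    by (intro enorm_equivalentI[of "c * real (card P) powr (1 / p - 1 / 2)" 1])
      (auto simp flip: l2_enorm_eq_block_enorm)
qed (use p in auto)

text \<open>Hoelder's inequality with exponents \<open>p/2\<close> and \<open>p/(p - 2)\<close>. It is obtained from Young's
  inequality after scaling \<open>x\<close> to \<open>\<ell>\<^sub>p\<close> norm \<open>1\<close>, which gives the constant \<open>(1 + C)\<^sup>p\<^sup>/\<^sup>2\<close>.\<close>

lemma sum_weighted_squares_le:
  fixes x w :: "'a \<Rightarrow> real"
  assumes p: "2 < p" and w: "\<And>j. j \<in> M \<Longrightarrow> 0 \<le> w j"
    and C: "(\<Sum>\<^sub>\<infinity>j\<in>M. ennreal (w j powr (2 * p / (p - 2)))) \<le> ennreal C" "0 \<le> C"
  shows "epowr (\<Sum>\<^sub>\<infinity>j\<in>M. ennreal ((x j * w j)\<^sup>2)) (p / 2)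
    \<le> ennreal ((1 + C) powr (p / 2)) * (\<Sum>\<^sub>\<infinity>j\<in>M. ennreal (\<bar>x j\<bar> powr p))"
proof (cases "(\<Sum>\<^sub>\<infinity>j\<in>M. ennreal (\<bar>x j\<bar> powr p))")
  case top
  then show ?thesis
    using C(2) by (simp add: ennreal_mult_top)
next
  case (real t)
  have x_le: "ennreal (\<bar>x j\<bar> powr p) \<le> ennreal t" if "j \<in> M" for j
    using member_le_infsum_ennreal[OF that, of "\<lambda>j. ennreal (\<bar>x j\<bar> powr p)"] real by simp
  show ?thesis
  proof (cases "t = 0")
    case True
    then have "x j = 0" if "j \<in> M" for j
      using x_le[OF that] by (simp add: ennreal_neg)
    then have "(\<Sum>\<^sub>\<infinity>j\<in>M. ennreal ((x j * w j)\<^sup>2)) = 0"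
      by (simp cong: infsum_cong)
    then show ?thesis
      by simp
  next
    case False
    with real have t: "t > 0"
      by simp
    have young: "(x j * w j)\<^sup>2 \<le> t powr (2 / p) * (\<bar>x j\<bar> powr p / t + w j powr (2 * p / (p - 2)))"
      if "j \<in> M" for j
    proof -
      \<comment> \<open>The square of the normalised coordinate, \<open>t\<^sup>1\<^sup>/\<^sup>p\<close> being the \<open>\<ell>\<^sub>p\<close> norm on \<open>M\<close>.\<close>
      define a where "a = (x j)\<^sup>2 / t powr (2 / p)"
      have a: "0 \<le> a" "(x j)\<^sup>2 = t powr (2 / p) * a"
        using t by (auto simp: a_def)
      have apow: "a powr (p / 2) = \<bar>x j\<bar> powr p / t"
      proof -
        have "(x j)\<^sup>2 powr (p / 2) = \<bar>x j\<bar> powr p"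
          using powr_powr[of "\<bar>x j\<bar>" 2 "p / 2"] by simp
        then show ?thesis
          using t p by (simp add: a_def powr_divide powr_powr)
      qed
      have wpow: "((w j)\<^sup>2) powr (p / (p - 2)) = w j powr (2 * p / (p - 2))"
        using powr_powr[of "w j" 2 "p / (p - 2)"] w[OF that] by simp
      have "a * (w j)\<^sup>2 \<le> a powr (p / 2) / (p / 2) + ((w j)\<^sup>2) powr (p / (p - 2)) / (p / (p - 2))"
      proof (rule Youngs_inequality)
        have "1 / (p / 2) + 1 / (p / (p - 2)) = (2 + (p - 2)) / p"
          by (simp only: add_divide_distrib) simp
        then show "1 / (p / 2) + 1 / (p / (p - 2)) = 1"
          using p by simp
      qed (use p a in \<open>auto simp: less_divide_eq\<close>)
      also have "\<dots> \<le> a powr (p / 2) + ((w j)\<^sup>2) powr (p / (p - 2))"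
      proof (intro add_mono)
        have shrink: "y / r \<le> y" if "0 \<le> y" "1 \<le> r" for y r :: real
          using divide_left_mono[of 1 r y] that by simp
        then show "a powr (p / 2) / (p / 2) \<le> a powr (p / 2)"
            "((w j)\<^sup>2) powr (p / (p - 2)) / (p / (p - 2)) \<le> ((w j)\<^sup>2) powr (p / (p - 2))"
          using p by (auto intro!: shrink simp: le_divide_eq simp del: divide_divide_eq_right)
      qed
      finally have "a * (w j)\<^sup>2 \<le> \<bar>x j\<bar> powr p / t + w j powr (2 * p / (p - 2))"
        by (simp only: apow wpow)
      then show ?thesis
        using mult_left_mono[of "a * (w j)\<^sup>2" _ "t powr (2 / p)"] a
        by (simp add: power_mult_distrib mult.assoc)
    qed
    have "(\<Sum>\<^sub>\<infinity>j\<in>M. ennreal ((x j * w j)\<^sup>2))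
        \<le> (\<Sum>\<^sub>\<infinity>j\<in>M. ennreal (t powr (2 / p)) * (ennreal (1 / t) * ennreal (\<bar>x j\<bar> powr p) + ennreal (w j powr (2 * p / (p - 2)))))"
      using t by (intro infsum_ennreal_mono ennreal_leI[OF young, THEN order_trans])
        (auto simp flip: ennreal_mult ennreal_plus)
    also have "\<dots> = ennreal (t powr (2 / p)) * (ennreal (1 / t) * ennreal t + (\<Sum>\<^sub>\<infinity>j\<in>M. ennreal (w j powr (2 * p / (p - 2)))))"
      unfolding infsum_ennreal_cmult infsum_ennreal_add real(2) ..
    also have "\<dots> \<le> ennreal (t powr (2 / p)) * (ennreal (1 / t) * ennreal t + ennreal C)"
      by (intro mult_left_mono add_left_mono C) auto
    also have "\<dots> = ennreal (t powr (2 / p) * (1 + C)) * 1"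
      using t C(2) by (simp flip: ennreal_mult ennreal_plus ennreal_1)
    finally have "epowr (\<Sum>\<^sub>\<infinity>j\<in>M. ennreal ((x j * w j)\<^sup>2)) (p / 2)
        \<le> ennreal ((t powr (2 / p) * (1 + C)) powr (p / 2)) * epowr 1 (p / 2)"
      by (rule epowr_scaled_le) (use p C(2) in auto)
    also have "epowr 1 (p / 2) = 1"
      using epowr_ennreal[of 1 "p / 2"] by simp
    also have "(t powr (2 / p) * (1 + C)) powr (p / 2) = (1 + C) powr (p / 2) * t"
      using t C(2) p by (simp add: powr_mult powr_powr)
    finally show ?thesis
      using real C(2) by (simp add: ennreal_mult)
  qed
qed

lemma partition_enorm_summable_weights_le:
  assumes p: "2 < p" and P: "partition_on A P" and w: "\<forall>k\<in>A. 0 < w k"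
    and C: "\<And>M. M \<in> P \<Longrightarrow> (\<Sum>\<^sub>\<infinity>j\<in>M. ennreal (w j powr (2 * p / (p - 2)))) \<le> ennreal C" "0 \<le> C"
  shows "partition_enorm p P w x \<le> ennreal (((1 + C) powr (p / 2)) powr (1 / p)) * lp_enorm p A x"
  unfolding partition_enorm_eq_block_enorm lp_enorm_eq_block_enorm
proof (rule block_enorm_le)
  have wpos: "0 \<le> w j" if "M \<in> P" "j \<in> M" for M j
    using P w that by (force simp: partition_on_def)
  have "block_sum p P (\<lambda>j. x j * w j) \<le> (\<Sum>\<^sub>\<infinity>M\<in>P. ennreal ((1 + C) powr (p / 2)) * (\<Sum>\<^sub>\<infinity>j\<in>M. ennreal (\<bar>x j\<bar> powr p)))"
    unfolding block_sum_def using wpos C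
    by (intro infsum_ennreal_mono sum_weighted_squares_le[OF p]) auto
  also have "\<dots> = ennreal ((1 + C) powr (p / 2)) * (\<Sum>\<^sub>\<infinity>M\<in>P. \<Sum>\<^sub>\<infinity>j\<in>M. ennreal (\<bar>x j\<bar> powr p))"
    by (rule infsum_ennreal_cmult)
  also have "(\<Sum>\<^sub>\<infinity>M\<in>P. \<Sum>\<^sub>\<infinity>j\<in>M. ennreal (\<bar>x j\<bar> powr p)) = (\<Sum>\<^sub>\<infinity>j\<in>A. ennreal (\<bar>x j\<bar> powr p))"
  proof -
    have "disjoint_family_on (\<lambda>M. M) P" "(\<Union>M\<in>P. M) = A"
      using P by (auto simp: partition_on_def disjoint_def disjoint_family_on_def)
    from infsum_ennreal_UN_disjoint[OF this(1)] this(2) show ?thesis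
      by simp
  qed
  finally show "block_sum p P (\<lambda>j. x j * w j) \<le> ennreal ((1 + C) powr (p / 2)) * block_sum p (singletons A) x"
    by (simp add: block_sum_singletons)
qed (use p in auto)

section \<open>Identification of \<open>X\<close>\<close>

theorem proposition4p2:
  fixes p :: real and A :: "'a set" and P1 P2 :: "'a set set" and w1 w2 :: "'a \<Rightarrow> real"
  assumes "2 < p"
    and "countable A" and "infinite A"
    and "partition_on A P1" and "partition_on A P2"
    and "\<forall>k\<in>A. 0 < w1 k \<and> w1 k \<le> 1"
    and "\<forall>k\<in>A. 0 < w2 k \<and> w2 k \<le> 1"
    and "\<forall>N\<in>P1. \<exists>M\<in>P2. N \<subseteq> M \<and> (\<forall>k\<in>N. w1 k \<ge> w2 k)"
  defines "X \<equiv> X_space p A P1 w1 P2 w2"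
    and "normX \<equiv> X_enorm p A P1 w1 P2 w2"
    and "norm2 \<equiv> lp_enorm 2 A"
  shows
    "(\<forall>\<delta>. (INF k\<in>A. w2 k) = \<delta> \<and> \<delta> > 0 \<longrightarrow>
       (finite P2 \<longrightarrow>
         (\<forall>x.
           ennreal (\<delta> * real (card P2) powr (1 / p - 1 / 2)) * norm2 x
             \<le> ennreal \<delta> * epowr (\<Sum>\<^sub>\<infinity>M\<in>P2. epowr (\<Sum>\<^sub>\<infinity>j\<in>M. ennreal ((x j)\<^sup>2)) (p / 2)) (1 / p) \<and>
           ennreal \<delta> * epowr (\<Sum>\<^sub>\<infinity>M\<in>P2. epowr (\<Sum>\<^sub>\<infinity>j\<in>M. ennreal ((x j)\<^sup>2)) (p / 2)) (1 / p)
             \<le> normX x \<and>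
           normX x \<le> norm2 x) \<and>
         X \<sim>\<^sub>B ell 2) \<and>
       (infinite P2 \<and> (\<forall>M\<in>P2. finite M) \<longrightarrow>
         enorm_equivalent normX
           (\<lambda>x. epowr (\<Sum>\<^sub>\<infinity>M\<in>P2. epowr (\<Sum>\<^sub>\<infinity>j\<in>M. ennreal ((x j)\<^sup>2)) (p / 2)) (1 / p)) \<and>
         X \<sim>\<^sub>B lp_sum p P2 (\<lambda>M. lp_space 2 M) \<and>
         X \<sim>\<^sub>B ell p) \<and>
       (infinite P2 \<and> {M\<in>P2. infinite M} \<noteq> {} \<and> finite {M\<in>P2. infinite M} \<longrightarrow>
         X \<sim>\<^sub>B ell 2 \<oplus>\<^sub>B ell p) \<and>
       (infinite P2 \<and> infinite {M\<in>P2. infinite M} \<longrightarrow>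
         enorm_equivalent normX
           (\<lambda>x. epowr
              ((\<Sum>\<^sub>\<infinity>M\<in>{M\<in>P2. infinite M}. epowr (\<Sum>\<^sub>\<infinity>j\<in>M. ennreal ((x j)\<^sup>2)) (p / 2)) +
               (\<Sum>\<^sub>\<infinity>M\<in>{M\<in>P2. finite M}. epowr (\<Sum>\<^sub>\<infinity>j\<in>M. ennreal ((x j)\<^sup>2)) (p / 2))) (1 / p)) \<and>
         X \<sim>\<^sub>B lp_sum p (UNIV :: nat set) (\<lambda>_. ell 2)))
     \<and>
     (\<forall>\<gamma>. (INF k\<in>A. w1 k) = \<gamma> \<and> \<gamma> > 0 \<and> (INF k\<in>A. w2 k) = 0 \<longrightarrow>
       (finite P1 \<longrightarrow>
         (\<forall>x.
           ennreal (\<gamma> * real (card P1) powr (1 / p - 1 / 2)) * norm2 x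
             \<le> ennreal \<gamma> * epowr (\<Sum>\<^sub>\<infinity>N\<in>P1. epowr (\<Sum>\<^sub>\<infinity>j\<in>N. ennreal ((x j)\<^sup>2)) (p / 2)) (1 / p) \<and>
           ennreal \<gamma> * epowr (\<Sum>\<^sub>\<infinity>N\<in>P1. epowr (\<Sum>\<^sub>\<infinity>j\<in>N. ennreal ((x j)\<^sup>2)) (p / 2)) (1 / p)
             \<le> normX x \<and>
           normX x \<le> norm2 x) \<and>
         X \<sim>\<^sub>B ell 2) \<and>
       (infinite P1 \<and> (\<forall>N\<in>P1. finite N) \<and>
         (\<forall>M\<in>P2. (\<Sum>\<^sub>\<infinity>n\<in>M. ennreal (w2 n powr (2 * p / (p - 2)))) < top) \<and>
         (SUP M\<in>P2. (\<Sum>\<^sub>\<infinity>n\<in>M. ennreal (w2 n powr (2 * p / (p - 2))))) < top \<longrightarrow>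
         X \<sim>\<^sub>B ell p))"
proof -
  have p: "2 < p" "0 < p"
    using assms(1) by simp_all
  note A = assms(2,3) and P = assms(4,5) and w = assms(6,7)
  have ref: "\<forall>N\<in>P1. \<exists>M\<in>P2. N \<subseteq> M"
    using assms(8) by blast
  have ref_refl: "\<forall>N\<in>P2. \<exists>M\<in>P2. N \<subseteq> M"
    by blast
  have A_ne: "A \<noteq> {}"
    using A by auto
  have inf_le: "\<forall>k\<in>A. (INF k\<in>A. v k) \<le> v k" if "\<forall>k\<in>A. 0 < v k \<and> v k \<le> 1" for v :: "'a \<Rightarrow> real"
    using that by (intro ballI cINF_lower bdd_belowI2[of _ 0]) (auto intro: less_imp_le)
  have U: "epowr (\<Sum>\<^sub>\<infinity>M\<in>Q. epowr (\<Sum>\<^sub>\<infinity>j\<in>M. ennreal ((x j)\<^sup>2)) (p / 2)) (1 / p) = block_enorm p Q x" for Q x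
    by (simp add: block_enorm_def block_sum_def)
  have norm2_eq: "norm2 = block_enorm p {A}"
    unfolding norm2_def by (rule l2_enorm_eq_block_enorm[OF p(2)])
  have normX_le_norm2: "normX x \<le> norm2 x" for x
    unfolding normX_def norm2_eq
    using partition_onD1[OF P(1)] partition_onD1[OF P(2)]
    by (intro X_enorm_le[OF p(1) P partition_on_trivial[OF A_ne] w]) auto
  have finite_case: "(\<forall>x. ennreal (c * real (card Q) powr (1 / p - 1 / 2)) * norm2 x \<le> ennreal c * block_enorm p Q x \<and>
        ennreal c * block_enorm p Q x \<le> normX x \<and> normX x \<le> norm2 x) \<and> X \<sim>\<^sub>B ell 2"
    if "finite Q" "partition_on A Q" "0 < c" and lower: "\<And>x. ennreal c * block_enorm p Q x \<le> normX x" for Q c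
  proof -
    have "X \<sim>\<^sub>B ell 2"
      unfolding X_def
      by (rule X_space_finite_partition[OF p(1) A that(2,1,3)])
        (use lower normX_le_norm2 in \<open>auto simp: normX_def norm2_def\<close>)
    moreover have "ennreal (c * real (card Q) powr (1 / p - 1 / 2)) * norm2 x \<le> ennreal c * block_enorm p Q x" for x
      unfolding norm2_def
      using finite_partition_l2_le[OF p(1) A_ne that(2,1)] that(3) by simp
    ultimately show ?thesis
      using lower normX_le_norm2 by blast
  qed
  have iso: "X \<sim>\<^sub>B Y" if "enorm_equivalent normX (block_enorm p Q)" "linear_iso (seq_space A (block_enorm p Q)) Y"
    for Q and Y :: "'y::real_vector nspace"
    unfolding X_def using X_space_isomorphic[OF p(2)] that unfolding normX_def by blast
  have part1: "(finite P2 \<longrightarrow> (\<forall>x. ennreal (\<delta> * real (card P2) powr (1 / p - 1 / 2)) * norm2 x \<le> ennreal \<delta> * block_enorm p P2 x \<and>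
        ennreal \<delta> * block_enorm p P2 x \<le> normX x \<and> normX x \<le> norm2 x) \<and> X \<sim>\<^sub>B ell 2)"
      "enorm_equivalent normX (block_enorm p P2)"
    if \<delta>: "(INF k\<in>A. w2 k) = \<delta> \<and> \<delta> > 0" for \<delta>
  proof -
    have w\<delta>: "\<forall>k\<in>A. \<delta> \<le> w2 k"
      using inf_le[OF w(2)] \<delta> by simp
    have lower: "ennreal \<delta> * block_enorm p P2 x \<le> normX x" for x
      unfolding normX_def using \<delta>
      by (intro order_trans[OF partition_enorm_ge[OF p(2) P(2) w\<delta>] le_X_enorm(3)]) simp
    have upper: "normX x \<le> ennreal 1 * block_enorm p P2 x" for x
      unfolding normX_def using X_enorm_le[OF p(1) P P(2) w ref ref_refl] by simp
    show "enorm_equivalent normX (block_enorm p P2)"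
      using \<delta> lower upper by (intro enorm_equivalentI[of \<delta> 1]) auto
    show "(finite P2 \<longrightarrow> (\<forall>x. ennreal (\<delta> * real (card P2) powr (1 / p - 1 / 2)) * norm2 x \<le> ennreal \<delta> * block_enorm p P2 x \<and>
        ennreal \<delta> * block_enorm p P2 x \<le> normX x \<and> normX x \<le> norm2 x) \<and> X \<sim>\<^sub>B ell 2)"
      using finite_case[OF _ P(2) _ lower] \<delta> by blast
  qed
  have split: "epowr ((\<Sum>\<^sub>\<infinity>M\<in>{M\<in>P2. infinite M}. epowr (\<Sum>\<^sub>\<infinity>j\<in>M. ennreal ((x j)\<^sup>2)) (p / 2)) +
      (\<Sum>\<^sub>\<infinity>M\<in>{M\<in>P2. finite M}. epowr (\<Sum>\<^sub>\<infinity>j\<in>M. ennreal ((x j)\<^sup>2)) (p / 2))) (1 / p) = block_enorm p P2 x" for x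
  proof -
    have "P2 = {M\<in>P2. infinite M} \<union> {M\<in>P2. finite M}"
      by blast
    then show ?thesis
      unfolding block_enorm_def block_sum_def
      by (metis (no_types, lifting) infsum_Un_disjoint[OF summable_on_ennreal_any summable_on_ennreal_any] disjoint_iff mem_Collect_eq)
  qed
  have part2: "(finite P1 \<longrightarrow> (\<forall>x. ennreal (\<gamma> * real (card P1) powr (1 / p - 1 / 2)) * norm2 x \<le> ennreal \<gamma> * block_enorm p P1 x \<and>
        ennreal \<gamma> * block_enorm p P1 x \<le> normX x \<and> normX x \<le> norm2 x) \<and> X \<sim>\<^sub>B ell 2)"
      "infinite P1 \<and> (\<forall>N\<in>P1. finite N) \<and>
         (\<forall>M\<in>P2. (\<Sum>\<^sub>\<infinity>n\<in>M. ennreal (w2 n powr (2 * p / (p - 2)))) < top) \<and>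
         (SUP M\<in>P2. (\<Sum>\<^sub>\<infinity>n\<in>M. ennreal (w2 n powr (2 * p / (p - 2))))) < top \<longrightarrow> X \<sim>\<^sub>B ell p"
    if \<gamma>: "(INF k\<in>A. w1 k) = \<gamma> \<and> \<gamma> > 0 \<and> (INF k\<in>A. w2 k) = 0" for \<gamma>
  proof -
    have w\<gamma>: "\<forall>k\<in>A. \<gamma> \<le> w1 k"
      using inf_le[OF w(1)] \<gamma> by simp
    have lower: "ennreal \<gamma> * block_enorm p P1 x \<le> normX x" for x
      unfolding normX_def using \<gamma>
      by (intro order_trans[OF partition_enorm_ge[OF p(2) P(1) w\<gamma>] le_X_enorm(2)]) simp
    show "(finite P1 \<longrightarrow> (\<forall>x. ennreal (\<gamma> * real (card P1) powr (1 / p - 1 / 2)) * norm2 x \<le> ennreal \<gamma> * block_enorm p P1 x \<and>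
        ennreal \<gamma> * block_enorm p P1 x \<le> normX x \<and> normX x \<le> norm2 x) \<and> X \<sim>\<^sub>B ell 2)"
      using finite_case[OF _ P(1) _ lower] \<gamma> by blast
    show "infinite P1 \<and> (\<forall>N\<in>P1. finite N) \<and>
         (\<forall>M\<in>P2. (\<Sum>\<^sub>\<infinity>n\<in>M. ennreal (w2 n powr (2 * p / (p - 2)))) < top) \<and>
         (SUP M\<in>P2. (\<Sum>\<^sub>\<infinity>n\<in>M. ennreal (w2 n powr (2 * p / (p - 2))))) < top \<longrightarrow> X \<sim>\<^sub>B ell p"
    proof (intro impI, elim conjE)
      assume inf: "infinite P1" and fin: "\<forall>N\<in>P1. finite N"
        and sup: "(SUP M\<in>P2. (\<Sum>\<^sub>\<infinity>n\<in>M. ennreal (w2 n powr (2 * p / (p - 2))))) < top"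
      define C where "C = enn2real (SUP M\<in>P2. (\<Sum>\<^sub>\<infinity>n\<in>M. ennreal (w2 n powr (2 * p / (p - 2)))))"
      have C: "(\<Sum>\<^sub>\<infinity>n\<in>M. ennreal (w2 n powr (2 * p / (p - 2)))) \<le> ennreal C" if "M \<in> P2" for M
        using SUP_upper[OF that, of "\<lambda>M. \<Sum>\<^sub>\<infinity>n\<in>M. ennreal (w2 n powr (2 * p / (p - 2)))"] sup
        by (simp add: C_def)
      define K where "K = max 1 (((1 + C) powr (p / 2)) powr (1 / p))"
      have lp_le: "lp_enorm p A x \<le> block_enorm p P1 x" for x
      proof -
        have "\<forall>N\<in>singletons A. \<exists>M\<in>P1. N \<subseteq> M"
          using P(1) by (auto simp: partition_on_def)
        then show ?thesis
          unfolding lp_enorm_eq_block_enorm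
          by (intro block_enorm_mono block_sum_refine[OF p(1) partition_on_singletons P(1)] p(2))
      qed
      have "normX x \<le> ennreal K * block_enorm p P1 x" for x
      proof -
        have one: "block_enorm p P1 x \<le> ennreal K * block_enorm p P1 x"
          using mult_right_mono[of 1 "ennreal K" "block_enorm p P1 x"] by (simp add: K_def ennreal_ge_1)
        have "partition_enorm p P2 w2 x \<le> ennreal (((1 + C) powr (p / 2)) powr (1 / p)) * lp_enorm p A x"
          by (rule partition_enorm_summable_weights_le[OF p(1) P(2) _ C]) (use w in \<open>auto simp: C_def\<close>)
        also have "\<dots> \<le> ennreal K * block_enorm p P1 x"
          by (intro mult_mono ennreal_leI lp_le) (auto simp: K_def)
        finally show ?thesis
          using order_trans[OF lp_le one] order_trans[OF partition_enorm_le[OF p(2) P(1) w(1)] one]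
          by (simp add: normX_def X_enorm_def)
      qed
      then have "enorm_equivalent normX (block_enorm p P1)"
        using \<gamma> lower by (intro enorm_equivalentI[of \<gamma> K]) (auto simp: K_def)
      then show "X \<sim>\<^sub>B ell p"
        by (rule iso[OF _ linear_iso_finite_blocks_ell[OF p(1) A(1) P(1) inf fin]])
    qed
  qed
  have iso_P2: "X \<sim>\<^sub>B lp_sum p P2 (\<lambda>M. lp_space 2 M)"
      "infinite P2 \<Longrightarrow> \<forall>M\<in>P2. finite M \<Longrightarrow> X \<sim>\<^sub>B ell p"
      "infinite P2 \<Longrightarrow> {M\<in>P2. infinite M} \<noteq> {} \<Longrightarrow> finite {M\<in>P2. infinite M} \<Longrightarrow> X \<sim>\<^sub>B ell 2 \<oplus>\<^sub>B ell p"
      "infinite {M\<in>P2. infinite M} \<Longrightarrow> X \<sim>\<^sub>B lp_sum p (UNIV :: nat set) (\<lambda>_. ell 2)"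
    if "(INF k\<in>A. w2 k) = \<delta> \<and> \<delta> > 0" for \<delta>
    by (intro iso[OF part1(2)[OF that]] linear_iso_lp_sum_blocks[OF p(2) P(2)]
        linear_iso_finite_blocks_ell[OF p(1) A(1) P(2)]
        linear_iso_finitely_many_infinite_blocks[OF p(1) A(1) P(2)]
        linear_iso_infinitely_many_infinite_blocks[OF p(1) A(1) P(2)]; assumption)+
  show ?thesis
    unfolding U split
    by (rule conjI; intro allI impI) (use part1 part2 iso_P2 in blast)+
qed

end
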